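(* Let $n\ge 3$, $k\ge 3$. For each $\alpha=a_1\cdots a_n\in\mathbf{A}_k(n)\setminus\{r_{n,k}\}$ let $p(\alpha)$ be the position modified by the parent rule, namely $p(\alpha)=j$ if $\mathrm{Par}(\alpha)=\mathrm{LastNonMax}(\alpha)$, $p(\alpha)=n$ if $\mathrm{Par}(\alpha)$ is obtained via $\mathrm{LastSymbol}$, $p(\alpha)=i$ if obtained via $\mathrm{FirstNonMin}$, and $p(\alpha)=\ell$ if obtained via $\mathrm{SecondLastNonMax}$ (with $i,j,\ell$ as defined below, and the case determined by the first operation in the list that yields an element of $\mathbf{A}_k(n)$). Let $s(\alpha)=a_{p+1}\cdots a_na_1\cdots a_{p-1}$ (length $n-1$) where $p=p(\alpha)$; thus $\alpha$ and $\mathrm{Par}(\alpha)$ are joined via the conjugate pair $(a_p s(\alpha),\, y\, s(\alpha))$ with $y\ne a_p$ and $y s(\alpha)\in[\mathrm{Par}(\alpha)]$. Then the tree induced by $\mathrm{Par}$ has the Chain Property: if $\alpha\neq\alpha'$ are elements of $\mathbf{A}_k(n)\setminus\{r_{n,k}\}$ with $\mathrm{Par}(\alpha)=\mathrm{Par}(\alpha')$, then $s(\alpha)\neq s(\alpha')$.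
   Context: Let $\Sigma=\{0,1,\dots,k-1\}$. Strings are compared lexicographically ($\alpha<\beta$ if $\alpha$ is a proper prefix of $\beta$, or $\alpha$ has the smaller symbol at the first index where they differ). For $\alpha=a_1\cdots a_n$, $\alpha^R=a_n\cdots a_1$; $[\alpha]$ is the set of rotations of $\alpha$. $\alpha$ is a necklace if it is the lexicographically smallest element of $[\alpha]$; a bracelet if it is the lexicographically smallest element of $[\alpha]\cup[\alpha^R]$. A necklace $\alpha$ is symmetric if $\alpha^R\in[\alpha]$, asymmetric otherwise. $\mathbf{A}_k(n)$ is the set of asymmetric bracelets of length $n$ over $\Sigma$. $r_{n,k}=0^{n-2}(k-2)(k-1)$. Operations on $\alpha=a_1\cdots a_n$: $\mathrm{LastNonMax}(\alpha)=a_1\cdots a_{j-1}(a_j+1)(k-1)^{n-j}$, where $j$ is the index of the last symbol different from $k-1$; $\mathrm{LastSymbol}(\alpha)$ is the necklace (smallest rotation) of $a_1\cdots a_{n-1}((a_n+1)\bmod k)$; $\mathrm{FirstNonMin}(\alpha)=0^{i-1}(a_i-1)a_{i+1}\cdots a_n$, where $i$ is the index of the first nonzero symbol; $\mathrm{SecondLastNonMax}(\alpha)=a_1\cdots a_{\ell-1}(a_\ell+1)a_{\ell+1}\cdots a_n$, where $\ell$ is the index of the second-last symbol different from $k-1$. Parent rule: for $\alpha\in\mathbf{A}_k(n)\setminus\{r_{n,k}\}$, $\mathrm{Par}(\alpha)$ is the first string in the list $\langle \mathrm{LastNonMax}(\alpha),\mathrm{LastSymbol}(\alpha),\mathrm{FirstNonMin}(\alpha),\mathrm{SecondLastNonMax}(\alpha)\rangle$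 that belongs to $\mathbf{A}_k(n)$ (this is always well defined). *)

theory Defs
  imports Main "HOL-Library.List_Lexorder"
begin

text \<open>Strings over {0,...,k-1} are lists of naturals. Lists are ordered lexicographically
  by the List_Lexorder instance (a proper prefix is smaller). Positions are 0-indexed
  internally; paper position p corresponds to list index p-1.\<close>

definition rotations :: "nat list \<Rightarrow> nat list set" where
  "rotations \<alpha> = {rotate i \<alpha> | i. i < length \<alpha>} \<union> {\<alpha>}"

definition is_necklace :: "nat list \<Rightarrow> bool" where
  "is_necklace \<alpha> \<longleftrightarrow> (\<forall>\<beta>\<in>rotations \<alpha>. \<alpha> \<le> \<beta>)"

definition is_bracelet :: "nat list \<Rightarrow> bool" where
  "is_bracelet \<alpha> \<longleftrightarrow> (\<forall>\<beta>\<in>rotations \<alpha> \<union> rotations (rev \<alpha>). \<alpha> \<le> \<beta>)"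

definition symmetric_necklace :: "nat list \<Rightarrow> bool" where
  "symmetric_necklace \<alpha> \<longleftrightarrow> rev \<alpha> \<in> rotations \<alpha>"

definition strings :: "nat \<Rightarrow> nat \<Rightarrow> nat list set" where
  "strings k n = {\<alpha>. length \<alpha> = n \<and> (\<forall>a\<in>set \<alpha>. a < k)}"

definition A :: "nat \<Rightarrow> nat \<Rightarrow> nat list set" where
  "A k n = {\<alpha> \<in> strings k n. is_bracelet \<alpha> \<and> is_necklace \<alpha> \<and> \<not> symmetric_necklace \<alpha>}"

definition r_str :: "nat \<Rightarrow> nat \<Rightarrow> nat list" where
  "r_str n k = replicate (n - 2) 0 @ [k - 2, k - 1]"

definition neck :: "nat list \<Rightarrow> nat list" where
  "neck \<alpha> = Min (rotations \<alpha>)"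

definition last_nonmax_idx :: "nat \<Rightarrow> nat list \<Rightarrow> nat option" where
  "last_nonmax_idx k \<alpha> = (if \<exists>i<length \<alpha>. \<alpha> ! i \<noteq> k - 1
     then Some (GREATEST i. i < length \<alpha> \<and> \<alpha> ! i \<noteq> k - 1) else None)"

definition second_last_nonmax_idx :: "nat \<Rightarrow> nat list \<Rightarrow> nat option" where
  "second_last_nonmax_idx k \<alpha> = (case last_nonmax_idx k \<alpha> of None \<Rightarrow> None
     | Some j \<Rightarrow> (if \<exists>i<j. \<alpha> ! i \<noteq> k - 1
         then Some (GREATEST i. i < j \<and> \<alpha> ! i \<noteq> k - 1) else None))"

definition first_nonmin_idx :: "nat list \<Rightarrow> nat option" where
  "first_nonmin_idx \<alpha> = (if \<exists>i<length \<alpha>. \<alpha> ! i \<noteq> 0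
     then Some (LEAST i. i < length \<alpha> \<and> \<alpha> ! i \<noteq> 0) else None)"

definition LastNonMax :: "nat \<Rightarrow> nat list \<Rightarrow> nat \<Rightarrow> nat list" where
  "LastNonMax k \<alpha> j = take j \<alpha> @ [\<alpha> ! j + 1] @ replicate (length \<alpha> - j - 1) (k - 1)"

definition LastSymbol :: "nat \<Rightarrow> nat list \<Rightarrow> nat list" where
  "LastSymbol k \<alpha> = neck (butlast \<alpha> @ [(last \<alpha> + 1) mod k])"

definition FirstNonMin :: "nat list \<Rightarrow> nat \<Rightarrow> nat list" where
  "FirstNonMin \<alpha> i = take i \<alpha> @ [\<alpha> ! i - 1] @ drop (i + 1) \<alpha>"

definition SecondLastNonMax :: "nat list \<Rightarrow> nat \<Rightarrow> nat list" where
  "SecondLastNonMax \<alpha> l = \<alpha>[l := \<alpha> ! l + 1]"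

definition cand_LNM :: "nat \<Rightarrow> nat list \<Rightarrow> (nat list \<times> nat) option" where
  "cand_LNM k \<alpha> = map_option (\<lambda>j. (LastNonMax k \<alpha> j, j)) (last_nonmax_idx k \<alpha>)"

definition cand_LS :: "nat \<Rightarrow> nat list \<Rightarrow> (nat list \<times> nat) option" where
  "cand_LS k \<alpha> = (if \<alpha> = [] then None else Some (LastSymbol k \<alpha>, length \<alpha> - 1))"

definition cand_FNM :: "nat list \<Rightarrow> (nat list \<times> nat) option" where
  "cand_FNM \<alpha> = map_option (\<lambda>i. (FirstNonMin \<alpha> i, i)) (first_nonmin_idx \<alpha>)"

definition cand_SLNM :: "nat \<Rightarrow> nat list \<Rightarrow> (nat list \<times> nat) option" where
  "cand_SLNM k \<alpha> = map_option (\<lambda>l. (SecondLastNonMax \<alpha> l, l)) (second_last_nonmax_idx k \<alpha>)"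

definition par_step :: "nat \<Rightarrow> nat list \<Rightarrow> (nat list \<times> nat) option" where
  "par_step k \<alpha> = find (\<lambda>c. fst c \<in> A k (length \<alpha>))
     (List.map_filter id [cand_LNM k \<alpha>, cand_LS k \<alpha>, cand_FNM \<alpha>, cand_SLNM k \<alpha>])"

definition Par :: "nat \<Rightarrow> nat list \<Rightarrow> nat list" where
  "Par k \<alpha> = fst (the (par_step k \<alpha>))"

text \<open>0-based modified position q = p(alpha) - 1.\<close>
definition ppos :: "nat \<Rightarrow> nat list \<Rightarrow> nat" where
  "ppos k \<alpha> = snd (the (par_step k \<alpha>))"

definition s_str :: "nat \<Rightarrow> nat list \<Rightarrow> nat list" where
  "s_str k \<alpha> = drop (ppos k \<alpha> + 1) \<alpha> @ take (ppos k \<alpha>) \<alpha>"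

end

theory Submission
  imports Defs
begin

text \<open>Suppose \<open>Par \<alpha> = Par \<alpha>'\<close> and \<open>s(\<alpha>) = s(\<alpha>')\<close>. Comparing letter sums, both strings are joined
  to the parent through the same letter \<open>y\<close>. All operations except FirstNonMin determine the
  modified letter from \<open>y\<close> as \<open>y - 1\<close> modulo \<open>k\<close>, and FirstNonMin determines it as \<open>y + 1\<close>, so if
  both strings are of the same type they are rotations of each other, hence equal. There remains
  the case that exactly one of them, say \<open>\<alpha> = 0\<^sup>t a \<beta>\<close>, uses FirstNonMin.

  The main tool: if \<open>LastNonMax \<alpha>\<close> is not an asymmetric bracelet, then
  \<open>\<alpha> = \<pi> (k-1)\<^sup>d (k-2) (k-1)\<^sup>q\<close> with a nonempty palindrome \<open>\<pi>\<close> and \<open>d < q\<close>. Moreover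
  FirstNonMin succeeds whenever \<open>a \<ge> 2\<close> or \<open>t = 0\<close>, and, if the last letter is \<open>k-1\<close>, LastSymbol
  succeeds whenever \<open>a\<close> is smaller than the second-last letter. Consequently SecondLastNonMax is
  only used for \<open>k = 3\<close> and \<open>\<alpha> = \<pi>12\<close>, where it always succeeds. In the remaining case
  \<open>\<alpha>'\<close> is \<open>0\<^sup>t (a-2) \<beta>\<close> modified at the letter \<open>a-2\<close>, or \<open>a = 1\<close> and \<open>\<alpha>'\<close> ends in the modified letter
  \<open>k-1\<close>; the constraints above then force one of the two strings to be the root \<open>r\<close> or symmetric.\<close>

section \<open>Cyclic readings of a word\<close>

text \<open>Words are handled as functions on indices, so that a cyclic reading is \<open>x\<close>
  composed with an index map and one lemma can serve rotations and reflections alike.\<close>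

definition lexlt :: "nat \<Rightarrow> (nat \<Rightarrow> nat) \<Rightarrow> (nat \<Rightarrow> nat) \<Rightarrow> bool" where
  "lexlt n f g \<longleftrightarrow> (\<exists>e<n. (\<forall>i<e. f i = g i) \<and> f e < g e)"

text \<open>\<open>fw n c i\<close> and \<open>bw n c i\<close> are the indices visited at step \<open>i\<close> when a cyclic word of length \<open>n\<close>
  is read forwards, respectively backwards, from index \<open>c\<close>.\<close>

definition fw :: "nat \<Rightarrow> nat \<Rightarrow> nat \<Rightarrow> nat" where
  "fw n c i = (if c + i < n then c + i else c + i - n)"

definition bw :: "nat \<Rightarrow> nat \<Rightarrow> nat \<Rightarrow> nat" where
  "bw n c i = (if i \<le> c then c - i else c + n - i)"

text \<open>Strictness for the backward readings encodes asymmetry.\<close>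

definition asym_bracelet :: "nat \<Rightarrow> nat \<Rightarrow> (nat \<Rightarrow> nat) \<Rightarrow> bool" where
  "asym_bracelet k n x \<longleftrightarrow> (\<forall>i<n. x i < k)
     \<and> (\<forall>c<n. \<not> lexlt n (\<lambda>i. x (fw n c i)) x)
     \<and> (\<forall>c<n. lexlt n x (\<lambda>i. x (bw n c i)))"

lemma fw_less: "c < n \<Longrightarrow> i < n \<Longrightarrow> fw n c i < n"
  by (auto simp: fw_def)

lemma bw_less: "c < n \<Longrightarrow> i < n \<Longrightarrow> bw n c i < n"
  by (auto simp: bw_def)

lemma fw_0: "i < n \<Longrightarrow> fw n 0 i = i"
  by (auto simp: fw_def)

lemma lexlt_cong:
  assumes "\<And>i. i < n \<Longrightarrow> f i = f' i" "\<And>i. i < n \<Longrightarrow> g i = g' i"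
  shows "lexlt n f g \<longleftrightarrow> lexlt n f' g'"
proof -
  have "(\<forall>i<e. f i = g i) \<and> f e < g e \<longleftrightarrow> (\<forall>i<e. f' i = g' i) \<and> f' e < g' e" if "e < n" for e
    using assms that by auto
  then show ?thesis unfolding lexlt_def by blast
qed

lemma lexlt_irrefl: "\<not> lexlt n f f"
  by (auto simp: lexlt_def)

lemma lexlt_asym: "lexlt n f g \<Longrightarrow> \<not> lexlt n g f"
proof
  assume "lexlt n f g" "lexlt n g f"
  then obtain d e where *: "\<forall>i<d. f i = g i" "f d < g d" "\<forall>i<e. g i = f i" "g e < f e"
    unfolding lexlt_def by blast
  consider "d < e" | "d = e" | "e < d" by linarith
  then show False using * by cases auto
qed

lemma lexltI: "e < n \<Longrightarrow> (\<And>i. i < e \<Longrightarrow> f i = g i) \<Longrightarrow> f e < g e \<Longrightarrow> lexlt n f g"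
  by (auto simp: lexlt_def)

lemma not_lexltD: "\<not> lexlt n g f \<Longrightarrow> e < n \<Longrightarrow> (\<And>i. i < e \<Longrightarrow> f i = g i) \<Longrightarrow> f e \<le> g e"
  unfolding lexlt_def by (metis not_le_imp_less)

lemma first_difference:
  fixes f g :: "nat \<Rightarrow> nat"
  assumes "\<not> lexlt n g f" "j < n" "f j \<noteq> g j"
  obtains e where "e \<le> j" "\<And>i. i < e \<Longrightarrow> f i = g i" "f e < g e"
proof -
  define e where "e = (LEAST i. f i \<noteq> g i)"
  have 1: "f e \<noteq> g e" unfolding e_def using assms(3) by (rule LeastI)
  have 2: "e \<le> j" unfolding e_def using assms(3) by (rule Least_le)
  have 3: "f i = g i" if "i < e" for i using that not_less_Least unfolding e_def by blast
  have "f e \<le> g e" using not_lexltD[OF assms(1), of e] 2 3 assms(2) by auto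
  with 1 have "f e < g e" by simp
  with 2 3 show ?thesis by (rule that)
qed

lemma asym_bracelet_cong:
  assumes "\<And>i. i < n \<Longrightarrow> x i = y i"
  shows "asym_bracelet k n x \<longleftrightarrow> asym_bracelet k n y"
proof -
  have "lexlt n (\<lambda>i. x (fw n c i)) x \<longleftrightarrow> lexlt n (\<lambda>i. y (fw n c i)) y" if "c < n" for c
    by (rule lexlt_cong) (use assms that fw_less in auto)
  moreover have "lexlt n x (\<lambda>i. x (bw n c i)) \<longleftrightarrow> lexlt n y (\<lambda>i. y (bw n c i))" if "c < n" for c
    by (rule lexlt_cong) (use assms that bw_less in auto)
  ultimately show ?thesis unfolding asym_bracelet_def using assms by auto
qed

section \<open>Translating lists into index functions\<close>

lemma list_less_iff_lexlt:
  fixes xs ys :: "nat list"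
  assumes "length xs = n" "length ys = n"
  shows "xs < ys \<longleftrightarrow> lexlt n ((!) xs) ((!) ys)"
proof -
  have "take e xs = take e ys \<longleftrightarrow> (\<forall>i<e. xs ! i = ys ! i)" if "e < n" for e
    using that assms by (auto simp: list_eq_iff_nth_eq)
  then show ?thesis
    using assms unfolding list_less_def lexord_take_index_conv lexlt_def by auto
qed

lemma nth_rotate_fw: "length \<alpha> = n \<Longrightarrow> c < n \<Longrightarrow> i < n \<Longrightarrow> rotate c \<alpha> ! i = \<alpha> ! fw n c i"
  by (auto simp: nth_rotate fw_def mod_if)

lemma nth_rotate_rev_bw:
  "length \<alpha> = n \<Longrightarrow> c < n \<Longrightarrow> i < n \<Longrightarrow> rotate c (rev \<alpha>) ! i = \<alpha> ! bw n (n - 1 - c) i"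
  by (auto simp: nth_rotate bw_def mod_if rev_nth intro!: arg_cong[where f="(!) \<alpha>"])

lemma rotations_eq: "\<alpha> \<noteq> [] \<Longrightarrow> rotations \<alpha> = {rotate c \<alpha> | c. c < length \<alpha>}"
  unfolding rotations_def by (auto intro: exI[of _ 0])

text \<open>Symmetry is phrased through rotations of \<open>rev \<alpha>\<close> because these are
  the words in the bracelet condition: asymmetry then means that none of those inequalities is an
  equality.\<close>

lemma symmetric_necklace_iff:
  assumes "\<alpha> \<noteq> []"
  shows "symmetric_necklace \<alpha> \<longleftrightarrow> (\<exists>c<length \<alpha>. \<alpha> = rotate c (rev \<alpha>))"
proof
  assume "symmetric_necklace \<alpha>"
  then obtain i where i: "i < length \<alpha>" "rev \<alpha> = rotate i \<alpha>"
    using assms by (auto simp: symmetric_necklace_def rotations_eq)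
  show "\<exists>c<length \<alpha>. \<alpha> = rotate c (rev \<alpha>)"
  proof (cases "i = 0")
    case True
    then show ?thesis using i by (intro exI[of _ 0]) simp
  next
    case False
    then have "rotate (length \<alpha> - i) (rev \<alpha>) = rev (rotate i \<alpha>)"
      using i(1) by (simp add: rotate_rev)
    also have "\<dots> = \<alpha>" using i(2) by (metis rev_rev_ident)
    finally show ?thesis using False i by (intro exI[of _ "length \<alpha> - i"]) auto
  qed
next
  assume "\<exists>c<length \<alpha>. \<alpha> = rotate c (rev \<alpha>)"
  then obtain c where c: "c < length \<alpha>" "\<alpha> = rotate c (rev \<alpha>)" by blast
  then have "rev \<alpha> = rotate (length \<alpha> - c) \<alpha>"
    using rotate_rev[of c \<alpha>] c by (simp add: rev_swap)
  then show "symmetric_necklace \<alpha>"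
    using c(1) unfolding symmetric_necklace_def rotations_def
    by (cases "c = 0") (simp, blast intro: diff_less)
qed

text \<open>Being a bracelet gives \<open>\<alpha> \<le> rotate c (rev \<alpha>)\<close>, and
  asymmetry excludes equality, so these inequalities become strict. Rotation \<open>c\<close> of the
  reverse is the backward reading from index \<open>n - 1 - c\<close>.\<close>

lemma A_iff_asym_bracelet:
  assumes "length \<alpha> = n" "0 < n"
  shows "\<alpha> \<in> A k n \<longleftrightarrow> asym_bracelet k n ((!) \<alpha>)"
proof -
  have ne: "\<alpha> \<noteq> []" "rev \<alpha> \<noteq> []" using assms by auto
  have F: "\<alpha> \<le> rotate c \<alpha> \<longleftrightarrow> \<not> lexlt n (\<lambda>i. \<alpha> ! fw n c i) ((!) \<alpha>)" if "c < n" for c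
  proof -
    have "\<alpha> \<le> rotate c \<alpha> \<longleftrightarrow> \<not> lexlt n ((!) (rotate c \<alpha>)) ((!) \<alpha>)"
      using list_less_iff_lexlt[of "rotate c \<alpha>" n \<alpha>] assms by (simp add: not_less[symmetric])
    then show ?thesis using lexlt_cong[of n "(!) (rotate c \<alpha>)" "\<lambda>i. \<alpha> ! fw n c i" "(!) \<alpha>" "(!) \<alpha>"]
      using nth_rotate_fw[OF assms(1) that] by auto
  qed
  have R: "\<alpha> < rotate c (rev \<alpha>) \<longleftrightarrow> lexlt n ((!) \<alpha>) (\<lambda>i. \<alpha> ! bw n (n - 1 - c) i)" if "c < n" for c
  proof -
    have "\<alpha> < rotate c (rev \<alpha>) \<longleftrightarrow> lexlt n ((!) \<alpha>) ((!) (rotate c (rev \<alpha>)))"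
      using list_less_iff_lexlt[of \<alpha> n "rotate c (rev \<alpha>)"] assms by simp
    then show ?thesis
      using lexlt_cong[of n "(!) \<alpha>" "(!) \<alpha>" "(!) (rotate c (rev \<alpha>))" "\<lambda>i. \<alpha> ! bw n (n - 1 - c) i"]
      using nth_rotate_rev_bw[OF assms(1) that] by auto
  qed
  have "\<alpha> \<in> A k n \<longleftrightarrow> (\<forall>i<n. \<alpha> ! i < k) \<and> (\<forall>c<n. \<alpha> \<le> rotate c \<alpha>) \<and> (\<forall>c<n. \<alpha> < rotate c (rev \<alpha>))"
  proof -
    have 1: "\<alpha> \<in> strings k n \<longleftrightarrow> (\<forall>i<n. \<alpha> ! i < k)"
      using assms by (simp add: strings_def all_set_conv_all_nth)
    have 2: "is_necklace \<alpha> \<longleftrightarrow> (\<forall>c<n. \<alpha> \<le> rotate c \<alpha>)"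
      unfolding is_necklace_def rotations_eq[OF ne(1)] using assms(1) by blast
    have 3: "is_bracelet \<alpha> \<longleftrightarrow> is_necklace \<alpha> \<and> (\<forall>c<n. \<alpha> \<le> rotate c (rev \<alpha>))"
      unfolding is_bracelet_def is_necklace_def rotations_eq[OF ne(2)] length_rev using assms(1) by blast
    have 4: "\<not> symmetric_necklace \<alpha> \<longleftrightarrow> (\<forall>c<n. \<alpha> \<noteq> rotate c (rev \<alpha>))"
      unfolding symmetric_necklace_iff[OF ne(1)] using assms(1) by blast
    show ?thesis
      unfolding A_def mem_Collect_eq 1 3 4 unfolding 2 order.strict_iff_order by blast
  qed
  moreover have "(\<forall>c<n. \<alpha> < rotate c (rev \<alpha>)) \<longleftrightarrow> (\<forall>c<n. lexlt n ((!) \<alpha>) (\<lambda>i. \<alpha> ! bw n c i))"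
  proof -
    have "(\<forall>c<n. \<alpha> < rotate c (rev \<alpha>)) \<longleftrightarrow> (\<forall>c<n. lexlt n ((!) \<alpha>) (\<lambda>i. \<alpha> ! bw n (n - 1 - c) i))"
      using R by auto
    also have "\<dots> \<longleftrightarrow> (\<forall>c<n. lexlt n ((!) \<alpha>) (\<lambda>i. \<alpha> ! bw n c i))"
    proof (intro iffI allI impI)
      fix c assume "\<forall>c<n. lexlt n ((!) \<alpha>) (\<lambda>i. \<alpha> ! bw n (n - 1 - c) i)" "c < n"
      then show "lexlt n ((!) \<alpha>) (\<lambda>i. \<alpha> ! bw n c i)"
        by (auto dest!: spec[of _ "n - 1 - c"])
    qed (use assms in auto)
    finally show ?thesis .
  qed
  ultimately show ?thesis using F unfolding asym_bracelet_def by auto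
qed

lemma asym_bracelet_fw: "asym_bracelet k n x \<Longrightarrow> c < n \<Longrightarrow> \<not> lexlt n (\<lambda>i. x (fw n c i)) x"
  by (simp add: asym_bracelet_def)

lemma asym_bracelet_bw: "asym_bracelet k n x \<Longrightarrow> c < n \<Longrightarrow> lexlt n x (\<lambda>i. x (bw n c i))"
  by (simp add: asym_bracelet_def)

lemma asym_bracelet_bounded: "asym_bracelet k n x \<Longrightarrow> i < n \<Longrightarrow> x i < k"
  by (simp add: asym_bracelet_def)

lemma asym_bracelet_first_le:
  assumes "asym_bracelet k n x" "c < n"
  shows "x 0 \<le> x c"
  using not_lexltD[OF asym_bracelet_fw[OF assms], of 0] assms(2) by (simp add: fw_def)

lemma asym_bracelet_not_palindrome:
  assumes "asym_bracelet k n x" "c < n"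
  shows "\<exists>i<n. x (bw n c i) \<noteq> x i"
proof -
  obtain e where "e < n" "x e < x (bw n c e)"
    using asym_bracelet_bw[OF assms] unfolding lexlt_def by blast
  then show ?thesis by (intro exI[of _ e]) simp
qed

text \<open>Strictness for \<open>c > 0\<close> lets forward and backward readings be treated by the
  same lemmas.\<close>

lemma asym_braceletI:
  assumes "\<And>i. i < n \<Longrightarrow> x i < k"
    and "\<And>c. 0 < c \<Longrightarrow> c < n \<Longrightarrow> lexlt n x (\<lambda>i. x (fw n c i))"
    and "\<And>c. c < n \<Longrightarrow> lexlt n x (\<lambda>i. x (bw n c i))"
  shows "asym_bracelet k n x"
proof -
  have "\<not> lexlt n (\<lambda>i. x (fw n c i)) x" if "c < n" for c
  proof (cases "c = 0")
    case True
    then show ?thesis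
      using lexlt_cong[of n "\<lambda>i. x (fw n c i)" x x x] lexlt_irrefl[of n x] by (simp add: fw_0)
  next
    case False
    then show ?thesis using assms(2) that lexlt_asym by blast
  qed
  then show ?thesis using assms(1,3) unfolding asym_bracelet_def by blast
qed

lemma fw_eq_iff:
  assumes "p < n" "c < n" "i < n"
  shows "fw n c i = p \<longleftrightarrow> i = (if c \<le> p then p - c else p + n - c)"
proof
  assume eq: "fw n c i = p"
  show "i = (if c \<le> p then p - c else p + n - c)"
    using assms(2,3) unfolding eq[symmetric] fw_def by (cases "c + i < n") simp_all
next
  assume "i = (if c \<le> p then p - c else p + n - c)"
  then show "fw n c i = p" using assms unfolding fw_def by (cases "c \<le> p") simp_all
qed

lemma bw_eq_iff:
  assumes "p < n" "c < n" "i < n"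
  shows "bw n c i = p \<longleftrightarrow> i = (if p \<le> c then c - p else c + n - p)"
proof
  assume eq: "bw n c i = p"
  show "i = (if p \<le> c then c - p else c + n - p)"
    using assms(2,3) unfolding eq[symmetric] bw_def by (cases "i \<le> c") simp_all
next
  assume "i = (if p \<le> c then c - p else c + n - p)"
  then show "bw n c i = p" using assms unfolding bw_def by (cases "p \<le> c") simp_all
qed

section \<open>The effect of changing one letter\<close>

text \<open>\<open>m\<close> is the step at which the reading \<open>\<phi>\<close> visits
  \<open>p\<close>. A first difference before step \<open>m\<close> is untouched by the change; if
  there is none, the reading gets the larger letter at step \<open>m\<close>, while the word itself
  changes only later, at \<open>p\<close>.\<close>

lemma lexlt_increment_early:
  assumes le: "\<not> lexlt n (\<lambda>i. x (\<phi> i)) x" and p: "p < n"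
    and m: "m < p" "\<And>i. i < n \<Longrightarrow> \<phi> i = p \<longleftrightarrow> i = m"
  shows "lexlt n (x(p := Suc (x p))) (\<lambda>i. (x(p := Suc (x p))) (\<phi> i))"
proof (cases "\<forall>i<m. x i = x (\<phi> i)")
  case True
  have "\<phi> m = p" using m p by simp
  moreover have "x m \<le> x (\<phi> m)" by (rule not_lexltD[OF le]) (use True m p in auto)
  moreover have "\<phi> i = p \<longleftrightarrow> i = m" if "i \<le> m" for i using m(2)[of i] that m(1) p by simp
  ultimately show ?thesis
    using m(1) p True by (intro lexltI[of m]) (auto simp: less_Suc_eq_le)
next
  case False
  then obtain j where "j < m" "x j \<noteq> x (\<phi> j)" by blast
  then obtain e where e: "e \<le> j" "\<And>i. i < e \<Longrightarrow> x i = x (\<phi> i)" "x e < x (\<phi> e)"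
    using first_difference[OF le, of j] m p by auto
  have "\<phi> i \<noteq> p" if "i < m" for i using m(2)[of i] that m(1) p by auto
  then show ?thesis
    using e \<open>j < m\<close> m(1) p by (intro lexltI[of e]) auto
qed

text \<open>If \<open>p\<close> is visited at step \<open>p\<close> or later, neither side changes
  before step \<open>p\<close>, so a first difference before \<open>p\<close> still decides. An
  earlier visit is the previous lemma.\<close>

lemma lexlt_increment:
  assumes le: "\<not> lexlt n (\<lambda>i. x (\<phi> i)) x" and p: "p < n"
    and m: "\<And>i. i < n \<Longrightarrow> \<phi> i = p \<longleftrightarrow> i = m"
    and j: "j < p" "x j \<noteq> x (\<phi> j)"
  shows "lexlt n (x(p := Suc (x p))) (\<lambda>i. (x(p := Suc (x p))) (\<phi> i))"
proof (cases "m < p")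
  case True
  then show ?thesis using lexlt_increment_early[OF le p True m] by blast
next
  case False
  obtain e where e: "e \<le> j" "\<And>i. i < e \<Longrightarrow> x i = x (\<phi> i)" "x e < x (\<phi> e)"
    using first_difference[OF le, of j] j p by auto
  have "\<phi> i \<noteq> p" if "i < p" for i using m[of i] that False p by auto
  then show ?thesis
    using e j p by (intro lexltI[of e]) auto
qed

text \<open>At step \<open>p\<close> both sides read the same letter, so the first difference lies
  elsewhere and survives.\<close>

lemma lexlt_update_fixed:
  assumes "lexlt n x (\<lambda>i. x (\<phi> i))" "\<And>i. i < n \<Longrightarrow> \<phi> i = p \<longleftrightarrow> i = p"
  shows "lexlt n (x(p := v)) (\<lambda>i. (x(p := v)) (\<phi> i))"
proof -
  obtain e where e: "e < n" "\<And>i. i < e \<Longrightarrow> x i = x (\<phi> i)" "x e < x (\<phi> e)"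
    using assms(1) unfolding lexlt_def by blast
  have "e \<noteq> p" using e(1,3) assms(2)[of e] by auto
  moreover have "\<phi> i = p \<longleftrightarrow> i = p" if "i \<le> e" for i using assms(2) e(1) that by simp
  ultimately show ?thesis using e by (intro lexltI[of e]) auto
qed

text \<open>In string notation: \<open>x = \<pi> (k-1)\<^sup>d (k-2) (k-1)\<^sup>q\<close> with a nonempty palindrome \<open>\<pi>\<close>
  and \<open>d < q\<close>, where \<open>j\<close> is the index of \<open>k-2\<close>.\<close>

definition palindromic_head :: "nat \<Rightarrow> nat \<Rightarrow> (nat \<Rightarrow> nat) \<Rightarrow> nat \<Rightarrow> nat \<Rightarrow> bool" where
  "palindromic_head k n x j d \<longleftrightarrow> d < j \<and> j + d + 1 < n \<and> x j = k - 2
     \<and> (\<forall>i. j < i \<and> i < n \<longrightarrow> x i = k - 1)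
     \<and> (\<forall>i. j - d \<le> i \<and> i < j \<longrightarrow> x i = k - 1)
     \<and> (\<forall>i<j - d. x i = x (j - d - 1 - i))"

text \<open>Forward readings cannot fail: from before \<open>j\<close> they meet the increment
  early, from \<open>j\<close> on they start with a letter exceeding the first one. So a backward
  reading from some \<open>c < j\<close> fails, and by the increment lemmas it agrees with
  \<open>x\<close> for \<open>j\<close> steps and visits \<open>j\<close> only after step
  \<open>j\<close>. This makes the letters up to \<open>c\<close> a palindrome and matches those
  between \<open>c\<close> and \<open>j\<close> with the maximal tail.\<close>

lemma increment_last_nonmax:
  assumes x: "asym_bracelet k n x" and j: "j < n" "x j \<noteq> k - 1"
    and tail: "\<And>i. j < i \<Longrightarrow> i < n \<Longrightarrow> x i = k - 1"
    and fail: "\<not> asym_bracelet k n (x(j := Suc (x j)))"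
  obtains d where "palindromic_head k n x j d"
proof -
  let ?y = "x(j := Suc (x j))"
  have xj: "x j < k - 1" using asym_bracelet_bounded[OF x j(1)] j(2) by simp
  have j0: "0 < j"
  proof (rule ccontr)
    assume "\<not> 0 < j"
    then have "x (bw n 0 i) = x i" if "i < n" for i
      using tail that by (cases "i = 0") (auto simp: bw_def)
    then show False using asym_bracelet_not_palindrome[OF x, of 0] j by auto
  qed
  have late: "?y 0 < ?y c" if "j \<le> c" "c < n" for c
    using asym_bracelet_first_le[OF x j(1)] tail[of c] that j0 xj by (cases "c = j") auto
  have "\<exists>c<n. \<not> lexlt n ?y (\<lambda>i. ?y (bw n c i))"
  proof (rule ccontr)
    assume bw: "\<not> ?thesis"
    have "asym_bracelet k n ?y"
    proof (rule asym_braceletI)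
      show "?y i < k" if "i < n" for i
        using asym_bracelet_bounded[OF x that] xj by auto
      show "lexlt n ?y (\<lambda>i. ?y (fw n c i))" if c: "0 < c" "c < n" for c
      proof (cases "j \<le> c")
        case True
        then show ?thesis using late[of c] c by (intro lexltI[of 0]) (auto simp: fw_def)
      next
        case False
        have m: "fw n c i = j \<longleftrightarrow> i = j - c" if "i < n" for i
          using fw_eq_iff[OF j(1) c(2) that] False by simp
        show ?thesis
          by (rule lexlt_increment_early[OF asym_bracelet_fw[OF x c(2)] j(1) _ m])
            (use False c in auto)
      qed
      show "lexlt n ?y (\<lambda>i. ?y (bw n c i))" if "c < n" for c using bw that by blast
    qed
    then show False using fail by blast
  qed
  then obtain c where c: "c < n" and bad: "\<not> lexlt n ?y (\<lambda>i. ?y (bw n c i))" by blast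
  have cj: "c < j"
  proof (rule ccontr)
    assume "\<not> c < j"
    then show False using late[of c] c bad lexltI[of 0 n ?y "\<lambda>i. ?y (bw n c i)"]
      by (simp add: bw_def)
  qed
  note lt = asym_bracelet_bw[OF x c]
  note le = lexlt_asym[OF lt]
  define m where "m = c + n - j"
  have m: "bw n c i = j \<longleftrightarrow> i = m" if "i < n" for i
    using bw_eq_iff[OF j(1) c that] cj by (simp add: m_def)
  have eq: "x i = x (bw n c i)" if "i < j" for i
    using lexlt_increment[OF le j(1) m that] bad by blast
  have "\<not> m < j"
    using lexlt_increment_early[OF le j(1) _ m] bad by blast
  moreover have "m \<noteq> j"
    using lexlt_update_fixed[OF lt, of j "Suc (x j)"] m bad by blast
  ultimately have mj: "j < m" by simp
  then have jn: "2 * j < c + n" using m_def by simp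
  have mid: "x i = k - 1" if "c < i" "i < j" for i
    using eq[OF that(2)] tail[of "c + n - i"] that c jn j by (simp add: bw_def)
  \<comment> \<open>At step \<open>j\<close> the reading is in the tail and shows
    \<open>k - 1\<close>; an incremented letter below \<open>k - 1\<close> would make this
    comparison strict, against \<open>bad\<close>.\<close>
  have xjk: "x j = k - 2"
  proof (rule ccontr)
    assume "x j \<noteq> k - 2"
    with xj have "Suc (x j) < k - 1" by simp
    moreover have "bw n c j = c + n - j" using cj by (simp add: bw_def)
    moreover have "x (c + n - j) = k - 1" using tail[of "c + n - j"] jn cj j by simp
    ultimately have less: "?y j < ?y (bw n c j)" using jn by auto
    have "?y i = ?y (bw n c i)" if "i < j" for i
    proof -
      have "bw n c i \<noteq> j" using m[of i] that mj j by auto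
      then show ?thesis using eq[OF that] that by simp
    qed
    then have "lexlt n ?y (\<lambda>i. ?y (bw n c i))" using less by (intro lexltI[OF j(1)])
    with bad show False by blast
  qed
  have "palindromic_head k n x j (j - 1 - c)"
    unfolding palindromic_head_def
  proof (intro conjI allI impI)
    show "j - 1 - c < j" "j + (j - 1 - c) + 1 < n" using cj jn by auto
    show "x j = k - 2" by (rule xjk)
    show "x i = k - 1" if "j < i \<and> i < n" for i using tail that by blast
    show "x i = k - 1" if "j - (j - 1 - c) \<le> i \<and> i < j" for i using mid that cj by simp
    show "x i = x (j - (j - 1 - c) - 1 - i)" if "i < j - (j - 1 - c)" for i
    proof -
      have "i \<le> c" "i < j" "j - (j - 1 - c) - 1 - i = c - i" using that cj by auto
      then show ?thesis using eq[of i] by (simp add: bw_def)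
    qed
  qed
  then show ?thesis by (rule that)
qed

text \<open>Let a reading visit \<open>t\<close> at a step other than \<open>t\<close>. If it agrees
  with \<open>x\<close> before step \<open>t\<close>, it has not yet visited \<open>t\<close>, and
  the smaller letter at \<open>t\<close> decides. A difference before step \<open>t\<close> sets a
  zero of \<open>x\<close> against a nonzero letter, which stays nonzero because then
  \<open>x t \<ge> 2\<close>. The strict forward part is stated separately because
  \<open>asym_bracelet\<close> records only non-strict forward comparisons.\<close>

lemma decrement_first_nonzero:
  assumes x: "asym_bracelet k n x" and t: "t < n" "x t \<noteq> 0" "\<And>i. i < t \<Longrightarrow> x i = 0"
    and z: "2 \<le> x t \<or> t = 0"
  defines "y \<equiv> x(t := x t - 1)"
  shows "\<And>c. 0 < c \<Longrightarrow> c < n \<Longrightarrow> lexlt n y (\<lambda>i. y (fw n c i))"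
    and "asym_bracelet k n y"
proof -
  have key: "lexlt n y (\<lambda>i. y (\<phi> i))"
    if le: "\<not> lexlt n (\<lambda>i. x (\<phi> i)) x"
      and m: "m < n" "\<And>i. i < n \<Longrightarrow> \<phi> i = t \<longleftrightarrow> i = m" "m \<noteq> t" for \<phi> m
  proof (cases "\<forall>i\<le>t. x i = x (\<phi> i)")
    case True
    have "\<phi> m = t" using m(1,2) by simp
    then have "\<not> m < t" using True t(2) t(3)[of m] by (metis less_imp_le)
    then have "\<phi> i \<noteq> t" if "i \<le> t" for i using m(2)[of i] m(3) that t(1) by auto
    then show ?thesis unfolding y_def
      using True t by (intro lexltI[of t]) auto
  next
    case False
    then obtain i where "i \<le> t" "x i \<noteq> x (\<phi> i)" by blast
    then obtain e where e: "e \<le> i" "\<And>i. i < e \<Longrightarrow> x i = x (\<phi> i)" "x e < x (\<phi> e)"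
      using first_difference[OF le, of i] t by auto
    have et: "e \<le> t" using e(1) \<open>i \<le> t\<close> by simp
    have early: "\<phi> i \<noteq> t" if "i < e" for i
      using e(2)[OF that] t(2) t(3)[of i] that et by auto
    show ?thesis
    proof (cases "e < t")
      case True
      then have "2 \<le> x t" using z by auto
      then have "y e < y (\<phi> e)" using e(3) t(3)[OF True] True unfolding y_def by auto
      then show ?thesis
        using early e(2) True t(1) unfolding y_def by (intro lexltI[of e]) auto
    next
      case False
      then have "e = t" using et by simp
      then have "\<phi> e \<noteq> t" using m(2)[of e] m(3) t(1) by auto
      then show ?thesis
        using early e(2,3) \<open>e = t\<close> t(1) unfolding y_def by (intro lexltI[of e]) auto
    qed
  qed
  show fw: "lexlt n y (\<lambda>i. y (fw n c i))" if c: "0 < c" "c < n" for c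
  proof -
    define m where "m = (if c \<le> t then t - c else t + n - c)"
    have "m < n" "m \<noteq> t" using c t(1) by (auto simp: m_def)
    moreover have "fw n c i = t \<longleftrightarrow> i = m" if "i < n" for i
      using fw_eq_iff[OF t(1) c(2) that] by (simp add: m_def)
    ultimately show ?thesis by (intro key[OF asym_bracelet_fw[OF x c(2)]])
  qed
  have bw: "lexlt n y (\<lambda>i. y (bw n c i))" if c: "c < n" for c
  proof -
    define m where "m = (if t \<le> c then c - t else c + n - t)"
    have mn: "m < n" using c t(1) by (auto simp: m_def)
    have m: "bw n c i = t \<longleftrightarrow> i = m" if "i < n" for i
      using bw_eq_iff[OF t(1) c that] by (simp add: m_def)
    show ?thesis
    proof (cases "m = t")
      case True
      then show ?thesis
        using lexlt_update_fixed[OF asym_bracelet_bw[OF x c], of t] m unfolding y_def by blast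
    next
      case False
      show ?thesis by (rule key[OF lexlt_asym[OF asym_bracelet_bw[OF x c]] mn m False])
    qed
  qed
  show "asym_bracelet k n y"
    by (rule asym_braceletI[OF _ fw bw])
      (use asym_bracelet_bounded[OF x] t(1) in \<open>auto simp: y_def less_imp_diff_less\<close>)
qed

section \<open>Comparing lengths of runs of zeros\<close>

lemma no_long_zero_run_fw:
  assumes x: "asym_bracelet k n x" and t: "t < n" "x t \<noteq> 0" "\<And>i. i < t \<Longrightarrow> x i = 0"
    and c: "c < n"
  obtains e where "e \<le> t" "x (fw n c e) \<noteq> 0"
proof (cases "\<exists>e\<le>t. x (fw n c e) \<noteq> 0")
  case False
  then have "lexlt n (\<lambda>i. x (fw n c i)) x"
    using t by (intro lexltI[of t]) auto
  then show ?thesis using asym_bracelet_fw[OF x c] by blast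
qed (use that in blast)

lemma no_long_zero_run_bw:
  assumes x: "asym_bracelet k n x" and t: "t < n" "x t \<noteq> 0" "\<And>i. i < t \<Longrightarrow> x i = 0"
    and c: "c < n"
  obtains e where "e \<le> t" "x (bw n c e) \<noteq> 0"
proof (cases "\<exists>e\<le>t. x (bw n c e) \<noteq> 0")
  case False
  then have "lexlt n (\<lambda>i. x (bw n c i)) x"
    using t by (intro lexltI[of t]) auto
  then show ?thesis using lexlt_asym[OF asym_bracelet_bw[OF x c]] by blast
qed (use that in blast)

text \<open>The reading shows its first nonzero letter while \<open>y\<close> is still zero.
  Comparison with a word starting with \<open>T\<close> zeros thus reduces to finding a nonzero
  letter among the first \<open>T\<close> steps.\<close>

lemma lexlt_fewer_zeros:
  assumes "e < T" "T < n" "\<And>i. i < T \<Longrightarrow> y i = 0" "g e \<noteq> (0::nat)"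
  shows "lexlt n y g"
proof -
  define d where "d = (LEAST i. g i \<noteq> 0)"
  have d: "g d \<noteq> 0" "d \<le> e" unfolding d_def
    using assms(4) by (auto intro: LeastI Least_le)
  have "g i = 0" if "i < d" for i using that not_less_Least unfolding d_def by blast
  then show ?thesis using d assms by (intro lexltI[of d]) auto
qed

text \<open>Zeroing \<open>x t\<close> lengthens the initial run of zeros to some
  \<open>T > t\<close>. A window of \<open>T\<close> letters starting elsewhere contains index
  \<open>T\<close>, or reaches the last letter, or lies beyond \<open>T\<close>, where the word is
  unchanged and \<open>t + 1\<close> zeros in a row cannot occur.\<close>

lemma zero_first_nonzero_strict:
  assumes x: "asym_bracelet k n x" and t: "t < n - 1" "x t \<noteq> 0" "\<And>i. i < t \<Longrightarrow> x i = 0"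
    and last: "x (n - 1) \<noteq> 0" and c: "0 < c" "c < n"
  shows "lexlt n (x(t := 0)) (\<lambda>i. (x(t := 0)) (fw n c i))"
proof -
  let ?y = "x(t := 0)"
  have yl: "?y (n - 1) \<noteq> 0" using t last by simp
  define T where "T = (LEAST i. ?y i \<noteq> 0)"
  have T: "?y T \<noteq> 0" "T \<le> n - 1" unfolding T_def
    using yl by (rule LeastI, rule Least_le)
  have zeros: "?y i = 0" if "i < T" for i using that not_less_Least unfolding T_def by blast
  have tT: "t < T" using T(1) t(3) by (metis fun_upd_apply linorder_neqE_nat)
  have "\<exists>e<T. ?y (fw n c e) \<noteq> 0"
  proof (cases "c \<le> T")
    case True
    then have "fw n c (T - c) = T" using T c by (auto simp: fw_def)
    then show ?thesis using T c True by (intro exI[of _ "T - c"]) auto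
  next
    case cT: False
    show ?thesis
    proof (cases "n \<le> c + T")
      case True
      then have "fw n c (n - 1 - c) = n - 1" "n - 1 - c < T" using c by (auto simp: fw_def)
      then show ?thesis using yl by metis
    next
      case False
      have tn: "t < n" using t(1) by simp
      obtain e where e: "e \<le> t" "x (fw n c e) \<noteq> 0"
        using no_long_zero_run_fw[OF x tn t(2,3) c(2)] by metis
      have "fw n c e = c + e" using e tT False by (auto simp: fw_def)
      then show ?thesis using e tT cT by (intro exI[of _ e]) auto
    qed
  qed
  then show ?thesis using lexlt_fewer_zeros[of _ T n ?y] T(2) zeros c by auto
qed

text \<open>\<open>y\<close> is \<open>x\<close> with its last letter replaced by 0 and moved to the
  front, so it starts with \<open>t + 1\<close> zeros. Other readings meet a nonzero letter sooner,
  except the backward one from \<open>t\<close>: it reads the same zeros and then wraps to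
  \<open>x (n - 2)\<close>, which exceeds \<open>x t\<close> by \<open>z\<close>.\<close>

lemma wrap_last_symbol:
  assumes x: "asym_bracelet k n x" and t: "t < n" "x t \<noteq> 0" "\<And>i. i < t \<Longrightarrow> x i = 0"
    and z: "x t < x (n - 2)" and n: "2 \<le> n"
  defines "y \<equiv> (\<lambda>i. if i = 0 then 0 else x (i - 1))"
  shows "asym_bracelet k n y"
proof -
  have tn: "t < n - 2" 
  proof -
    have "t \<noteq> n - 2" using z by auto
    moreover have "\<not> n - 2 < t" using t(3)[of "n - 2"] z by auto
    ultimately show ?thesis by simp
  qed
  have zeros: "y i = 0" if "i < Suc t" for i using that t(3) by (auto simp: y_def)
  have yl: "y (n - 1) = x (n - 2)" using tn by (auto simp: y_def numeral_2_eq_2)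
  show ?thesis
  proof (rule asym_braceletI)
    show "y i < k" if "i < n" for i
      using asym_bracelet_bounded[OF x, of "i - 1"] asym_bracelet_bounded[OF x t(1)] that
      by (auto simp: y_def)
    show "lexlt n y (\<lambda>i. y (fw n c i))" if c: "0 < c" "c < n" for c
    proof -
      have "\<exists>e<Suc t. y (fw n c e) \<noteq> 0"
      proof (cases "n \<le> c + t")
        case True
        then have "fw n c (n - 1 - c) = n - 1" "n - 1 - c < Suc t" using c by (auto simp: fw_def)
        then show ?thesis using yl z by (metis not_less0)
      next
        case False
        have c': "c - 1 < n" using c by simp
        obtain e where e: "e \<le> t" "x (fw n (c - 1) e) \<noteq> 0"
          using no_long_zero_run_fw[OF x t c'] by metis
        have "y (fw n c e) = x (fw n (c - 1) e)" using e False c by (auto simp: fw_def y_def)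
        then show ?thesis using e by (intro exI[of _ e]) auto
      qed
      then show ?thesis using lexlt_fewer_zeros[of _ "Suc t" n y] zeros tn by auto
    qed
    show "lexlt n y (\<lambda>i. y (bw n c i))" if c: "c < n" for c
    proof (cases "c = t")
      case True
      have "y (bw n c (Suc t)) = x (n - 2)" using True yl tn by (simp add: bw_def)
      moreover have "y (bw n c i) = 0" if "i < Suc t" for i
        using that True zeros by (auto simp: bw_def)
      ultimately show ?thesis using z zeros tn
        by (intro lexltI[of "Suc t"]) (auto simp: y_def)
    next
      case ct: False
      have "\<exists>e<Suc t. y (bw n c e) \<noteq> 0"
      proof (cases "c < t")
        case True
        then have "y (bw n c (Suc c)) = x (n - 2)" using yl by (simp add: bw_def)
        then show ?thesis using True z by (intro exI[of _ "Suc c"]) auto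
      next
        case False
        have c': "c - 1 < n" using c by simp
        obtain e where e: "e \<le> t" "x (bw n (c - 1) e) \<noteq> 0"
          using no_long_zero_run_bw[OF x t c'] by metis
        have "y (bw n c e) = x (bw n (c - 1) e)" using e False ct c by (auto simp: bw_def y_def)
        then show ?thesis using e by (intro exI[of _ e]) auto
      qed
      then show ?thesis using lexlt_fewer_zeros[of _ "Suc t" n y] zeros tn by auto
    qed
  qed
qed

text \<open>As in \<open>increment_last_nonmax\<close>, only a backward reading can fail; it would
  agree with \<open>x\<close> for \<open>n - 3\<close> steps and visit \<open>n - 3\<close> at step
  \<open>n - 2\<close> or \<open>n - 1\<close>.\<close>

lemma increment_second_last_nonmax:
  assumes x: "asym_bracelet k n x" and k: "3 \<le> k"
    and t: "0 < t" "t < n - 2" "x t = 1" "\<And>i. i < t \<Longrightarrow> x i = 0"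
    and end_x: "x (n - 2) = 1" "x (n - 1) = 2"
    and pal: "\<And>i. i < n - 2 \<Longrightarrow> x i = x (n - 3 - i)"
  shows "asym_bracelet k n (x(n - 3 := 1))"
proof -
  have n: "4 \<le> n" and tn: "t < n" using t by auto
  have x0: "x 0 = 0" using t by simp
  have x3: "x (n - 3) = 0" using pal[of 0] n x0 by simp
  have "x 1 \<le> 1" using t by (cases "t = 1") auto
  moreover have "n - 3 - 1 = n - 4" using n by simp
  ultimately have x4: "x (n - 4) \<le> 1" using pal[of 1] n by simp
  have p: "n - 3 < n" using n by simp
  let ?y = "x(n - 3 := Suc (x (n - 3)))"
  have "asym_bracelet k n ?y"
  proof (rule asym_braceletI)
    show "?y i < k" if "i < n" for i using asym_bracelet_bounded[OF x that] x3 k by simp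
    show "lexlt n ?y (\<lambda>i. ?y (fw n c i))" if c: "0 < c" "c < n" for c
    proof (cases "n - 3 < c")
      case True
      then have "c = n - 2 \<or> c = n - 1" using c by auto
      then have "?y 0 < ?y (fw n c 0)" using end_x x0 n by (auto simp: fw_def)
      then show ?thesis using c by (intro lexltI[of 0]) auto
    next
      case False
      have m: "fw n c i = n - 3 \<longleftrightarrow> i = n - 3 - c" if "i < n" for i
        using fw_eq_iff[OF p c(2) that] False by simp
      show ?thesis
        by (rule lexlt_increment_early[OF asym_bracelet_fw[OF x c(2)] p _ m])
          (use False c n in auto)
    qed
    show "lexlt n ?y (\<lambda>i. ?y (bw n c i))" if c: "c < n" for c
    proof (rule ccontr)
      assume bad: "\<not> ?thesis"
      note lt = asym_bracelet_bw[OF x c]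
      note le = lexlt_asym[OF lt]
      define m where "m = (if n - 3 \<le> c then c - (n - 3) else c + n - (n - 3))"
      have mn: "m < n" using c n by (auto simp: m_def)
      have m: "bw n c i = n - 3 \<longleftrightarrow> i = m" if "i < n" for i
        using bw_eq_iff[OF p c that] by (simp add: m_def)
      have eq: "x i = x (bw n c i)" if "i < n - 3" for i
        using lexlt_increment[OF le p m that] bad by blast
      have "\<not> m < n - 3" using lexlt_increment_early[OF le p _ m] bad by blast
      moreover have "m \<noteq> n - 3"
        using lexlt_update_fixed[OF lt, of "n - 3" "Suc (x (n - 3))"] m bad by blast
      ultimately consider "m = n - 2" | "m = n - 1" using mn by linarith
      then show False
      proof cases
        \<comment> \<open>Step \<open>n - 4\<close> then reads the final 2, but the palindrome gives
          \<open>x (n - 4) \<le> 1\<close>.\<close>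
        case 1
        then have "bw n c (n - 4) = n - 1"
          using m_def n c by (auto simp: bw_def split: if_splits)
        then show False using eq[of "n - 4"] x4 end_x n by simp
      next
        \<comment> \<open>The reading starts just before the zero at \<open>n - 3\<close>; agreeing
          with the \<open>t\<close> initial zeros of \<open>x\<close>, it would produce
          \<open>t + 1\<close> zeros in a row.\<close>
        case 2
        obtain e where e: "e \<le> t" "x (bw n (n - 3) e) \<noteq> 0"
          using no_long_zero_run_bw[OF x tn _ t(4) p] t(3) by auto
        have "e \<noteq> 0"
          by (rule notI) (use e(2) x3 in \<open>simp add: bw_def\<close>)
        then have "bw n (n - 3) e = bw n c (e - 1)"
          using 2 m_def n c e t by (auto simp: bw_def split: if_splits)
        moreover have "e - 1 < n - 3" "e - 1 < t" using e t \<open>e \<noteq> 0\<close> by auto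
        ultimately show False using eq[of "e - 1"] t(4)[of "e - 1"] e by simp
      qed
    qed
  qed
  then show ?thesis using x3 by simp
qed

section \<open>The parent rule\<close>

lemma last_nonmax_idxE:
  assumes "\<exists>i<length \<alpha>. \<alpha> ! i \<noteq> k - 1"
  obtains j where "last_nonmax_idx k \<alpha> = Some j" "j < length \<alpha>" "\<alpha> ! j \<noteq> k - 1"
    "\<And>i. j < i \<Longrightarrow> i < length \<alpha> \<Longrightarrow> \<alpha> ! i = k - 1"
proof -
  let ?P = "\<lambda>i. i < length \<alpha> \<and> \<alpha> ! i \<noteq> k - 1"
  define j where "j = Greatest ?P"
  obtain i0 where i0: "?P i0" using assms by blast
  have "?P j" unfolding j_def by (rule GreatestI_nat[of ?P i0 "length \<alpha>"]) (use i0 in auto)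
  moreover have "i \<le> j" if "?P i" for i unfolding j_def
    by (rule Greatest_le_nat[of ?P i "length \<alpha>"]) (use that in auto)
  moreover have "last_nonmax_idx k \<alpha> = Some j"
    using assms by (simp add: last_nonmax_idx_def j_def)
  ultimately show ?thesis using that[of j] by (meson leD)
qed

lemma first_nonmin_idxE:
  assumes "\<exists>i<length \<alpha>. \<alpha> ! i \<noteq> 0"
  obtains t where "first_nonmin_idx \<alpha> = Some t" "t < length \<alpha>" "\<alpha> ! t \<noteq> 0"
    "\<And>i. i < t \<Longrightarrow> \<alpha> ! i = 0"
proof -
  let ?P = "\<lambda>i. i < length \<alpha> \<and> \<alpha> ! i \<noteq> 0"
  define t where "t = Least ?P"
  obtain i0 where i0: "?P i0" using assms by blast
  have t: "?P t" unfolding t_def using i0 by (rule LeastI)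
  have "\<not> ?P i" if "i < t" for i using that not_less_Least unfolding t_def by blast
  then have "\<alpha> ! i = 0" if "i < t" for i using that t by (meson less_trans)
  moreover have "first_nonmin_idx \<alpha> = Some t"
    using assms by (simp add: first_nonmin_idx_def t_def)
  ultimately show ?thesis using that[of t] t by blast
qed

lemma second_last_nonmax_idx_eq:
  assumes "last_nonmax_idx k \<alpha> = Some j" "l < j" "\<alpha> ! l \<noteq> k - 1"
    and "\<And>i. l < i \<Longrightarrow> i < j \<Longrightarrow> \<alpha> ! i = k - 1"
  shows "second_last_nonmax_idx k \<alpha> = Some l"
proof -
  have "(GREATEST i. i < j \<and> \<alpha> ! i \<noteq> k - 1) = l"
    by (rule Greatest_equality) (use assms in \<open>auto intro: leI\<close>)
  then show ?thesis using assms by (auto simp: second_last_nonmax_idx_def)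
qed

lemma LastNonMax_eq:
  assumes "j < length \<alpha>" "\<And>i. j < i \<Longrightarrow> i < length \<alpha> \<Longrightarrow> \<alpha> ! i = k - 1"
  shows "LastNonMax k \<alpha> j = \<alpha>[j := Suc (\<alpha> ! j)]"
proof -
  have "drop (Suc j) \<alpha> = replicate (length \<alpha> - j - 1) (k - 1)"
    using assms by (intro nth_equalityI) auto
  then show ?thesis using assms(1) by (simp add: LastNonMax_def upd_conv_take_nth_drop)
qed

lemma FirstNonMin_eq: "i < length \<alpha> \<Longrightarrow> FirstNonMin \<alpha> i = \<alpha>[i := \<alpha> ! i - 1]"
  by (simp add: FirstNonMin_def upd_conv_take_nth_drop)

section \<open>Rotations and necklaces\<close>

lemma rotate_mem_rotations: "rotate m \<alpha> \<in> rotations \<alpha>"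
proof (cases "\<alpha> = []")
  case False
  then have "rotate m \<alpha> = rotate (m mod length \<alpha>) \<alpha>" "m mod length \<alpha> < length \<alpha>"
    by (auto simp: rotate_conv_mod[symmetric])
  then show ?thesis unfolding rotations_def by blast
qed (simp add: rotations_def)

lemma rotationsE:
  assumes "\<beta> \<in> rotations \<alpha>"
  obtains m where "\<beta> = rotate m \<alpha>"
  using assms unfolding rotations_def by (auto intro: that[of 0])

lemma finite_rotations: "finite (rotations \<alpha>)"
  unfolding rotations_def by simp

lemma sum_list_neck: "sum_list (neck \<alpha>) = sum_list \<alpha>"
proof -
  have "neck \<alpha> \<in> rotations \<alpha>" unfolding neck_def
    by (rule Min_in[OF finite_rotations]) (simp add: rotations_def)
  then obtain m where "neck \<alpha> = rotate m \<alpha>" by (rule rotationsE)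
  then have "sum_list (neck \<alpha>)
      = sum_list (take (m mod length \<alpha>) \<alpha> @ drop (m mod length \<alpha>) \<alpha>)"
    by (simp only: rotate_drop_take sum_list_append add.commute)
  then show ?thesis by simp
qed

lemma neck_rotate:
  assumes "is_necklace \<beta>"
  shows "neck (rotate m \<beta>) = \<beta>"
  unfolding neck_def
proof (rule Min_eqI[OF finite_rotations])
  fix \<gamma> assume "\<gamma> \<in> rotations (rotate m \<beta>)"
  then obtain i where "\<gamma> = rotate (i + m) \<beta>" by (auto elim: rotationsE simp: rotate_rotate)
  then show "\<beta> \<le> \<gamma>" using assms rotate_mem_rotations unfolding is_necklace_def by blast
next
  \<comment> \<open>The two rotations add up to \<open>m\<close> full turns.\<close>
  have "rotate (length \<beta> * m - m) (rotate m \<beta>) = \<beta>"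
  proof (cases "\<beta> = []")
    case False
    then have "m \<le> length \<beta> * m" by (cases \<beta>) auto
    then show ?thesis by (simp add: rotate_rotate)
  qed simp
  then show "\<beta> \<in> rotations (rotate m \<beta>)" using rotate_mem_rotations by metis
qed

text \<open>The necklace \<open>\<alpha>\<close> is a rotation of \<open>\<beta>\<close> and at most
  \<open>\<beta>\<close>, so strictness leaves only the trivial rotation. Strictness also excludes
  periods, which is why the position is determined as well.\<close>

lemma rotate_necklace_strict_unique:
  assumes len: "length \<beta> = n" "length \<alpha> = n" and t: "t < n" "p < n"
    and eq: "rotate t \<beta> = rotate p \<alpha>" and \<alpha>: "is_necklace \<alpha>"
    and strict: "\<And>c. 0 < c \<Longrightarrow> c < n \<Longrightarrow> \<beta> < rotate c \<beta>"
  shows "\<alpha> = \<beta>" "p = t"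
proof -
  define c where "c = (n - p + t) mod n"
  have "\<alpha> = rotate (n - p) (rotate p \<alpha>)" using len t by (simp add: rotate_rotate rotate_id)
  also have "\<dots> = rotate (n - p + t) \<beta>" by (simp add: eq[symmetric] rotate_rotate)
  also have "\<dots> = rotate c \<beta>" unfolding c_def using len rotate_conv_mod[of "n - p + t" \<beta>] by simp
  finally have \<alpha>_eq: "\<alpha> = rotate c \<beta>" .
  have "\<beta> = rotate (n - t) (rotate t \<beta>)" using len t by (simp add: rotate_rotate rotate_id)
  then have "\<beta> \<in> rotations \<alpha>" using eq rotate_mem_rotations by (metis rotate_rotate)
  then have "\<alpha> \<le> \<beta>" using \<alpha> unfolding is_necklace_def by blast
  moreover have "c < n" using t by (simp add: c_def)
  ultimately have c0: "c = 0" using strict[of c] \<alpha>_eq by (metis leD not_gr_zero)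
  then show "\<alpha> = \<beta>" using \<alpha>_eq by simp
  show "p = t"
  proof (cases "t < p")
    case True
    then show ?thesis using c0 t by (simp add: c_def)
  next
    case False
    then have *: "n - p + t = n + (t - p)" using t by simp
    have "t - p = 0" using c0 t unfolding c_def * by simp
    then show ?thesis using False by simp
  qed
qed

lemma rotate_necklace_unique:
  assumes "rotate t \<beta> = rotate p \<alpha>" "is_necklace \<alpha>" "is_necklace \<beta>"
  shows "\<alpha> = \<beta>"
  using neck_rotate assms by metis

lemma r_str_eqI:
  assumes "length \<alpha> = n" "3 \<le> n" "\<And>i. i < n - 2 \<Longrightarrow> \<alpha> ! i = 0" "\<alpha> ! (n - 2) = k - 2" "\<alpha> ! (n - 1) = k - 1"
  shows "\<alpha> = r_str n k"
proof (rule nth_equalityI)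
  show "length \<alpha> = length (r_str n k)" using assms by (simp add: r_str_def)
  fix i assume "i < length \<alpha>"
  then consider "i < n - 2" | "i = n - 2" | "i = n - 1" using assms by linarith
  then show "\<alpha> ! i = r_str n k ! i"
    using assms by cases (auto simp: r_str_def nth_append)
qed

lemma A_length: "\<alpha> \<in> A k n \<Longrightarrow> length \<alpha> = n"
  by (simp add: A_def strings_def)

lemma A_necklace: "\<alpha> \<in> A k n \<Longrightarrow> is_necklace \<alpha>"
  by (simp add: A_def)

lemma A_update_iff:
  assumes "length \<alpha> = n" "0 < n"
  shows "\<alpha>[p := v] \<in> A k n \<longleftrightarrow> asym_bracelet k n (((!) \<alpha>)(p := v))"
proof -
  have "\<alpha>[p := v] \<in> A k n \<longleftrightarrow> asym_bracelet k n ((!) (\<alpha>[p := v]))"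
    using assms by (intro A_iff_asym_bracelet) auto
  also have "\<dots> \<longleftrightarrow> asym_bracelet k n (((!) \<alpha>)(p := v))"
    by (rule asym_bracelet_cong) (use assms in \<open>auto simp: nth_list_update\<close>)
  finally show ?thesis .
qed

lemma palindromic_head_last: "palindromic_head k n x j d \<Longrightarrow> x (n - 1) = k - 1"
  unfolding palindromic_head_def by auto

text \<open>Since \<open>k - 1\<close> wraps to 0, the changed word is a rotation of
  \<open>0 # butlast \<alpha>\<close>, which \<open>wrap_last_symbol\<close> places in
  \<open>A k n\<close>; as a necklace it is its own smallest rotation.\<close>

lemma LastSymbol_mem_A:
  assumes \<alpha>: "\<alpha> \<in> A k n" and n: "3 \<le> n" and k: "0 < k"
    and t: "t < n" "\<alpha> ! t \<noteq> 0" "\<And>i. i < t \<Longrightarrow> \<alpha> ! i = 0"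
    and z: "\<alpha> ! t < \<alpha> ! (n - 2)" and last: "\<alpha> ! (n - 1) = k - 1"
  shows "LastSymbol k \<alpha> \<in> A k n"
proof -
  note len = A_length[OF \<alpha>]
  have ne: "\<alpha> \<noteq> []" using len n by auto
  let ?\<beta> = "0 # butlast \<alpha>"
  have "asym_bracelet k n (\<lambda>i. if i = 0 then 0 else \<alpha> ! (i - 1))"
    by (rule wrap_last_symbol[where t = t]) (use \<alpha> len n t z A_iff_asym_bracelet[of \<alpha> n k] in auto)
  also have "asym_bracelet k n (\<lambda>i. if i = 0 then 0 else \<alpha> ! (i - 1)) \<longleftrightarrow> asym_bracelet k n ((!) ?\<beta>)"
    by (rule asym_bracelet_cong) (use len n in \<open>auto simp: nth_Cons' nth_butlast\<close>)
  finally have \<beta>: "?\<beta> \<in> A k n" using len n A_iff_asym_bracelet[of ?\<beta> n k] by auto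
  have "LastSymbol k \<alpha> = neck (rotate 1 ?\<beta>)"
    using last ne len k by (simp add: LastSymbol_def last_conv_nth)
  also have "\<dots> = ?\<beta>" by (rule neck_rotate[OF A_necklace[OF \<beta>]])
  finally show ?thesis using \<beta> by simp
qed

lemma ex_not_const:
  assumes "asym_bracelet k n x" "0 < n"
  shows "\<exists>i<n. x i \<noteq> v"
proof (rule ccontr)
  assume "\<not> ?thesis"
  then have "x (bw n 0 i) = x i" if "i < n" for i using that bw_less[of 0 n i] assms(2) by auto
  then show False using asym_bracelet_not_palindrome[OF assms] by blast
qed

text \<open>Each case keeps what the failure of earlier operations yields: a failed
  \<open>LastNonMax\<close> gives \<open>palindromic_head\<close>, a failed
  \<open>LastSymbol\<close> bounds the second-last letter by the first nonzero one.\<close>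

lemma par_step_cases:
  assumes \<alpha>: "\<alpha> \<in> A k n" and r: "\<alpha> \<noteq> r_str n k" and n: "3 \<le> n" and k: "3 \<le> k"
  obtains
    (LNM) j where "par_step k \<alpha> = Some (\<alpha>[j := Suc (\<alpha> ! j)], j)" "j < n" "\<alpha> ! j < k - 1"
      "\<And>i. j < i \<Longrightarrow> i < n \<Longrightarrow> \<alpha> ! i = k - 1"
  | (LS) j d where "par_step k \<alpha> = Some (LastSymbol k \<alpha>, n - 1)" "palindromic_head k n ((!) \<alpha>) j d"
  | (FNM) t j d where "par_step k \<alpha> = Some (\<alpha>[t := \<alpha> ! t - 1], t)" "t < n" "\<alpha> ! t \<noteq> 0"
      "\<And>i. i < t \<Longrightarrow> \<alpha> ! i = 0" "\<alpha>[t := \<alpha> ! t - 1] \<in> A k n" "\<alpha> ! (n - 2) \<le> \<alpha> ! t"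
      "palindromic_head k n ((!) \<alpha>) j d"
  | (SLNM) "par_step k \<alpha> = Some (\<alpha>[n - 3 := 1], n - 3)" "k = 3" "\<alpha> ! (n - 1) = 2"
      "\<alpha> ! (n - 2) = 1" "\<alpha> ! (n - 3) = 0"
proof -
  note len = A_length[OF \<alpha>]
  have ne: "\<alpha> \<noteq> []" and n0: "0 < n" using len n by auto
  have x: "asym_bracelet k n ((!) \<alpha>)" using \<alpha> A_iff_asym_bracelet[OF len n0] by simp
  obtain j where j: "last_nonmax_idx k \<alpha> = Some j" "j < n" "\<alpha> ! j \<noteq> k - 1"
    and tail: "\<And>i. j < i \<Longrightarrow> i < n \<Longrightarrow> \<alpha> ! i = k - 1"
    using last_nonmax_idxE[of \<alpha> k] ex_not_const[OF x n0] len by metis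
  obtain t where t: "first_nonmin_idx \<alpha> = Some t" "t < n" "\<alpha> ! t \<noteq> 0"
    and zeros: "\<And>i. i < t \<Longrightarrow> \<alpha> ! i = 0"
    using first_nonmin_idxE[of \<alpha>] ex_not_const[OF x n0] len by metis
  have cLNM: "cand_LNM k \<alpha> = Some (\<alpha>[j := Suc (\<alpha> ! j)], j)"
    using j tail len by (simp add: cand_LNM_def LastNonMax_eq)
  have cLS: "cand_LS k \<alpha> = Some (LastSymbol k \<alpha>, n - 1)"
    using ne len by (simp add: cand_LS_def)
  have cFNM: "cand_FNM \<alpha> = Some (\<alpha>[t := \<alpha> ! t - 1], t)"
    using t len by (simp add: cand_FNM_def FirstNonMin_eq)
  note ps = par_step_def List.map_filter_simps cLNM cLS cFNM len
  show ?thesis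
  proof (cases "\<alpha>[j := Suc (\<alpha> ! j)] \<in> A k n")
    case True
    have "\<alpha> ! j < k - 1" using asym_bracelet_bounded[OF x j(2)] j(3) by simp
    then show ?thesis using LNM[of j] True j tail by (simp add: ps)
  next
    case noLNM: False
    obtain d where head: "palindromic_head k n ((!) \<alpha>) j d"
      by (rule increment_last_nonmax[OF x j(2,3) tail])
        (use noLNM A_update_iff[OF len n0] in auto)
    show ?thesis
    proof (cases "LastSymbol k \<alpha> \<in> A k n")
      case True
      then show ?thesis using LS[of j d] noLNM head by (simp add: ps)
    next
      case noLS: False
      have le: "\<alpha> ! (n - 2) \<le> \<alpha> ! t"
      proof (rule ccontr)
        assume "\<not> ?thesis"
        then show False
          using LastSymbol_mem_A[OF \<alpha> n _ t(2,3) zeros _ palindromic_head_last[OF head]] k noLS by simp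
      qed
      show ?thesis
      proof (cases "\<alpha>[t := \<alpha> ! t - 1] \<in> A k n")
        case True
        then show ?thesis
          using FNM[of t j d] noLNM noLS t zeros le head by (simp add: ps)
      next
        case noFNM: False
        have "\<not> (2 \<le> \<alpha> ! t \<or> t = 0)"
          using decrement_first_nonzero(2)[OF x t(2,3) zeros] noFNM A_update_iff[OF len n0] by blast
        then have t1: "\<alpha> ! t = 1" "0 < t" using t(3) by auto
        have jn: "j + d + 1 < n" using head by (simp add: palindromic_head_def)
        \<comment> \<open>The second-last letter is at most 1, hence not part of the tail of letters
          \<open>k - 1\<close>; so \<open>k - 2\<close> stands at \<open>n - 2\<close>, and
          \<open>k - 2 \<le> 1\<close> gives \<open>k = 3\<close>.\<close>
        have "\<not> j < n - 2" using tail[of "n - 2"] le t1 n k by auto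
        then have jd: "j = n - 2" "d = 0" using jn by auto
        have "\<alpha> ! (n - 2) = k - 2" using head jd by (simp add: palindromic_head_def)
        then have k3: "k = 3" and a2: "\<alpha> ! (n - 2) = 1" using le t1 k by auto
        have a1: "\<alpha> ! (n - 1) = 2" using palindromic_head_last[OF head] k3 by simp
        have "\<not> n - 2 < t" using zeros[of "n - 2"] a2 by auto
        moreover have "t \<noteq> n - 2"
        proof
          assume "t = n - 2"
          then have "\<alpha> = r_str n k" using zeros a1 a2 k3 by (intro r_str_eqI[OF len n]) simp_all
          then show False using r by simp
        qed
        ultimately have tn: "t < n - 2" by simp
        have pal: "\<alpha> ! i = \<alpha> ! (n - 3 - i)" if "i < n - 2" for i
        proof -
          have "\<forall>i<n - 2 - 0. \<alpha> ! i = \<alpha> ! (n - 2 - 0 - 1 - i)"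
            using head unfolding palindromic_head_def jd by blast
          moreover have "n - 2 - 0 - 1 - i = n - 3 - i" by simp
          ultimately show ?thesis using that by (metis diff_zero)
        qed
        have a3: "\<alpha> ! (n - 3) = 0" using pal[of 0] zeros t1 n by simp
        have "\<alpha>[n - 3 := 1] \<in> A k n"
          using increment_second_last_nonmax[OF x k t1(2) tn t1(1) zeros a2 a1 pal]
            A_update_iff[OF len n0] by simp
        moreover have "second_last_nonmax_idx k \<alpha> = Some (n - 3)"
          using j(1) jd(1) n k3 a3 by (intro second_last_nonmax_idx_eq) auto
        then have "cand_SLNM k \<alpha> = Some (\<alpha>[n - 3 := 1], n - 3)"
          using a3 by (simp add: cand_SLNM_def SecondLastNonMax_def)
        ultimately have "par_step k \<alpha> = Some (\<alpha>[n - 3 := 1], n - 3)"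
          using noLNM noLS noFNM by (simp add: ps)
        then show ?thesis using k3 a1 a2 a3 by (rule SLNM)
      qed
    qed
  qed
qed

section \<open>The Chain Property\<close>

lemma sum_list_update:
  fixes \<alpha> :: "nat list"
  assumes "p < length \<alpha>"
  shows "sum_list (\<alpha>[p := v]) = v + sum_list (drop (Suc p) \<alpha> @ take p \<alpha>)"
  using assms by (simp add: upd_conv_take_nth_drop)

lemma rotate_eq_Cons: "p < length \<alpha> \<Longrightarrow> rotate p \<alpha> = \<alpha> ! p # drop (Suc p) \<alpha> @ take p \<alpha>"
  by (simp add: rotate_drop_take Cons_nth_drop_Suc[symmetric])

text \<open>Putting the same letter in front of the same \<open>s\<close> gives a common rotation,
  and a rotation class contains only one necklace.\<close>

lemma A_joined_same_letter:
  assumes "\<alpha> \<in> A k n" "\<beta> \<in> A k n" "p < n" "q < n" "\<alpha> ! p = \<beta> ! q"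
    and "drop (Suc p) \<alpha> @ take p \<alpha> = drop (Suc q) \<beta> @ take q \<beta>"
  shows "\<alpha> = \<beta>"
proof -
  have len: "length \<alpha> = n" "length \<beta> = n" using assms A_length by auto
  have "rotate p \<alpha> = rotate q \<beta>" using assms(3-6) len by (simp add: rotate_eq_Cons)
  then show ?thesis using rotate_necklace_unique[of q \<beta> p \<alpha>] A_necklace assms(1,2) by simp
qed

text \<open>The FirstNonMin parent of \<open>\<alpha>\<close> has the letter \<open>a - 1\<close> in place of \<open>a = \<alpha> ! t\<close>; writing \<open>a - 2\<close> there
  instead yields a string strictly smaller than its nontrivial rotations, so a necklace joined
  to the same parent through the letter \<open>a - 2\<close> must be this very string.\<close>

lemma FNM_sibling_eq:
  assumes n: "3 \<le> n" and k: "3 \<le> k" and \<beta>: "\<beta> \<in> A k n"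
    and t: "t < n" "2 \<le> \<alpha> ! t" "\<And>i. i < t \<Longrightarrow> \<alpha> ! i = 0"
    and par: "\<alpha>[t := \<alpha> ! t - 1] \<in> A k n"
    and head: "palindromic_head k n ((!) \<alpha>) j d"
    and p: "p < n" "\<beta> ! p = \<alpha> ! t - 2"
    and eq: "drop (Suc t) \<alpha> @ take t \<alpha> = drop (Suc p) \<beta> @ take p \<beta>"
  shows "\<beta> = \<alpha>[t := \<alpha> ! t - 2]" "p = t"
proof -
  have len: "length \<alpha> = n" "length \<beta> = n" using A_length[OF par] A_length[OF \<beta>] by auto
  let ?w = "\<alpha>[t := \<alpha> ! t - 2]"
  let ?x = "((!) \<alpha>)(t := \<alpha> ! t - 1)"
  have x: "asym_bracelet k n ?x" using par A_update_iff[of \<alpha> n] len n by simp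
  have upd: "?x(t := ?x t - 1) = ((!) \<alpha>)(t := \<alpha> ! t - 2)"
    by (simp add: numeral_2_eq_2)
  \<comment> \<open>The parent has \<open>\<alpha> ! t - 1\<close> at \<open>t\<close>. If this is
    at least 2, \<open>decrement_first_nonzero\<close> covers one more decrement; if it is 1, the
    new letter is 0 and runs of zeros are compared instead.\<close>
  have strict: "lexlt n (((!) \<alpha>)(t := \<alpha> ! t - 2)) (\<lambda>i. (((!) \<alpha>)(t := \<alpha> ! t - 2)) (fw n c i))"
    if c: "0 < c" "c < n" for c
  proof (cases "\<alpha> ! t = 2")
    case False
    then have "2 \<le> ?x t" using t(2) by simp
    then show ?thesis
      using decrement_first_nonzero(1)[OF x t(1) _ _ _ c] t(3) unfolding upd by auto
  next
    case True
    have last: "\<alpha> ! (n - 1) = k - 1" by (rule palindromic_head_last[OF head])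
    have j: "j < n - 1" "\<alpha> ! j \<noteq> 0" using head k by (auto simp: palindromic_head_def)
    have "t < n - 1" using t(3)[of j] j t(1) by (meson linorder_not_le order.strict_trans2)
    then have "lexlt n (?x(t := 0)) (\<lambda>i. (?x(t := 0)) (fw n c i))"
      using True t(3) last k c by (intro zero_first_nonzero_strict[OF x]) auto
    then show ?thesis using True by simp
  qed
  have lyndon: "?w < rotate c ?w" if c: "0 < c" "c < n" for c
  proof -
    have "?w < rotate c ?w \<longleftrightarrow> lexlt n ((!) ?w) ((!) (rotate c ?w))"
      using list_less_iff_lexlt[of ?w n "rotate c ?w"] len by simp
    also have "\<dots> \<longleftrightarrow> lexlt n (((!) \<alpha>)(t := \<alpha> ! t - 2)) (\<lambda>i. (((!) \<alpha>)(t := \<alpha> ! t - 2)) (fw n c i))"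
      by (rule lexlt_cong)
        (use len c fw_less in \<open>auto simp: nth_rotate_fw[of _ n] nth_list_update\<close>)
    finally show ?thesis using strict[OF c] by simp
  qed
  have "rotate t ?w = rotate p \<beta>"
    using t(1) p eq len by (simp add: rotate_eq_Cons)
  then show "\<beta> = ?w" "p = t"
    using rotate_necklace_strict_unique[of ?w n \<beta> t p] len t(1) p(1) A_necklace[OF \<beta>] lyndon by auto
qed

text \<open>Excludes a \<open>LastNonMax\<close> sibling at position \<open>t\<close>, which would
  need only letters \<open>k - 1\<close> after \<open>t\<close>. In that situation
  \<open>k - 2\<close> would stand at \<open>t\<close>, and \<open>le\<close> would force
  \<open>t = n - 2\<close>, giving the root.\<close>

lemma FNM_nonmax_after_first_nonmin:
  assumes n: "3 \<le> n" and k: "3 \<le> k" and \<alpha>: "\<alpha> \<in> A k n" "\<alpha> \<noteq> r_str n k"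
    and zeros: "\<And>i. i < t \<Longrightarrow> \<alpha> ! i = 0"
    and le: "\<alpha> ! (n - 2) \<le> \<alpha> ! t" and head: "palindromic_head k n ((!) \<alpha>) j d"
  shows "\<exists>i. t < i \<and> i < n \<and> \<alpha> ! i \<noteq> k - 1"
proof (rule ccontr)
  assume "\<not> ?thesis"
  then have max: "\<alpha> ! i = k - 1" if "t < i" "i < n" for i using that by blast
  have j: "j < n - 1" "\<alpha> ! j = k - 2" using head by (auto simp: palindromic_head_def)
  have "j < n" using j(1) by simp
  then have "\<not> t < j" using max[of j] j(2) k by linarith
  moreover have "\<not> j < t" using zeros[of j] j k by auto
  ultimately have "j = t" by simp
  have "\<not> t < n - 2" using max[of "n - 2"] le \<open>j = t\<close> j k n by auto
  then have "t = n - 2" using j \<open>j = t\<close> by simp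
  then have "\<alpha> = r_str n k"
    using zeros j \<open>j = t\<close> palindromic_head_last[OF head]
    by (intro r_str_eqI[OF A_length[OF \<alpha>(1)] n]) simp_all
  then show False using \<alpha>(2) by simp
qed

text \<open>Here \<open>le\<close> forces \<open>k = 3\<close> and
  \<open>\<alpha> = \<pi>12\<close>, and comparing ends gives \<open>t = 0\<close>. Then
  \<open>\<beta>\<close> is \<open>\<alpha>\<close> without its first letter, followed by 2. The two
  overlapping palindromes make the head constant, so \<open>\<alpha>\<close> is a run of ones
  followed by 2, which is symmetric.\<close>

lemma FNM_not_joined_LS:
  assumes n: "3 \<le> n" and k: "3 \<le> k" and \<alpha>: "\<alpha> \<in> A k n" "\<alpha> \<noteq> r_str n k" and \<beta>: "\<beta> \<in> A k n"
    and t: "t < n" "\<alpha> ! t = 1" "\<And>i. i < t \<Longrightarrow> \<alpha> ! i = 0"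
    and le: "\<alpha> ! (n - 2) \<le> 1" and head: "palindromic_head k n ((!) \<alpha>) j d"
    and head': "palindromic_head k n ((!) \<beta>) j' d'"
  shows "drop (Suc t) \<alpha> @ take t \<alpha> \<noteq> butlast \<beta>"
proof
  assume eq: "drop (Suc t) \<alpha> @ take t \<alpha> = butlast \<beta>"
  note len = A_length[OF \<alpha>(1)] A_length[OF \<beta>]
  have \<beta>_nth: "\<beta> ! i = (drop (Suc t) \<alpha> @ take t \<alpha>) ! i" if "i < n - 1" for i
    using that len by (simp add: eq nth_butlast)
  have jn: "j + d + 1 < n" and tail: "\<And>i. j < i \<Longrightarrow> i < n \<Longrightarrow> \<alpha> ! i = k - 1"
    and aj: "\<alpha> ! j = k - 2"
    using head by (auto simp: palindromic_head_def)
  have jn': "j' + d' + 1 < n" "d' < j'" and tail': "\<And>i. j' < i \<Longrightarrow> i < n \<Longrightarrow> \<beta> ! i = k - 1"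
    and aj': "\<beta> ! j' = k - 2"
    using head' by (auto simp: palindromic_head_def)
  have "\<not> j < n - 2" using tail[of "n - 2"] le n k by auto
  then have jd: "j = n - 2" "d = 0" using jn by auto
  then have k3: "k = 3" and a2: "\<alpha> ! (n - 2) = 1" using aj le k by auto
  have a1: "\<alpha> ! (n - 1) = 2" using palindromic_head_last[OF head] k3 by simp
  have "\<not> n - 2 < t" using t(3)[of "n - 2"] a2 by auto
  moreover have "t \<noteq> n - 2"
  proof
    assume "t = n - 2"
    then have "\<alpha> = r_str n k" using t(3) a1 a2 k3 by (intro r_str_eqI[OF len(1) n]) simp_all
    then show False using \<alpha>(2) by simp
  qed
  ultimately have tn: "t < n - 2" by simp
  \<comment> \<open>The second-last letter of \<open>\<beta>\<close> is \<open>k - 2\<close> or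
    \<open>k - 1\<close>, whereas for \<open>t > 0\<close> it would be one of the initial zeros of
    \<open>\<alpha>\<close>.\<close>
  have "\<beta> ! (n - 2) \<noteq> 0" using tail'[of "n - 2"] aj' jn' n k by (cases "j' = n - 2") auto
  moreover have "\<beta> ! (n - 2) = 0" if "0 < t"
  proof -
    have idx: "n - 2 < n - 1" "\<not> n - 2 < n - Suc t" "n - 2 - (n - Suc t) = t - 1"
      using that tn by auto
    then have "\<beta> ! (n - 2) = take t \<alpha> ! (t - 1)"
      using \<beta>_nth[OF idx(1)] len by (simp only: nth_append length_drop if_False)
    then show ?thesis using t(3)[of "t - 1"] that by simp
  qed
  ultimately have t0: "t = 0" by auto
  have \<beta>_shift: "\<beta> ! i = \<alpha> ! Suc i" if "i < n - 1" for i
    using \<beta>_nth[OF that] that len t0 by simp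
  have pal: "\<alpha> ! i = \<alpha> ! (n - 3 - i)" if "i < n - 2" for i
  proof -
    have "\<forall>i<n - 2 - 0. \<alpha> ! i = \<alpha> ! (n - 2 - 0 - 1 - i)"
      using head unfolding palindromic_head_def jd by blast
    moreover have "n - 2 - 0 - 1 - i = n - 3 - i" by simp
    ultimately show ?thesis using that by (metis diff_zero)
  qed
  have a3: "\<alpha> ! (n - 3) = 1" using pal[of 0] t t0 n by simp
  have b2: "\<beta> ! (n - 2) = 2" using \<beta>_shift[of "n - 2"] a1 n by (simp add: Suc_diff_Suc numeral_2_eq_2)
  have b3: "\<beta> ! (n - 3) = 1" using \<beta>_shift[of "n - 3"] a2 n by (simp add: Suc_diff_Suc numeral_3_eq_3 numeral_2_eq_2)
  have "j' \<noteq> n - 2" using b2 aj' k3 by auto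
  moreover have "\<not> j' < n - 3" using tail'[of "n - 3"] b3 k3 n by auto
  ultimately have j': "j' = n - 3" using jn' by linarith
  have n4: "4 \<le> n" using jn' j' by simp
  \<comment> \<open>A nonzero \<open>d'\<close> would put \<open>k - 1\<close> at index
    \<open>n - 4\<close>, where \<open>\<beta>\<close> has the letter
    \<open>\<alpha> ! (n - 3) = 1\<close>.\<close>
  have d': "d' = 0"
  proof (rule ccontr)
    assume "d' \<noteq> 0"
    then have "n - 3 - d' \<le> n - 4" "n - 4 < n - 3" using n4 by auto
    then have "\<beta> ! (n - 4) = k - 1" using head' unfolding palindromic_head_def j' by blast
    moreover have "Suc (n - 4) = n - 3" using n4 by simp
    ultimately show False using \<beta>_shift[of "n - 4"] a3 k3 n4 by simp
  qed
  \<comment> \<open>Mirroring in the head of \<open>\<beta>\<close> and then in that of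
    \<open>\<alpha>\<close> moves an index by one.\<close>
  have step: "\<alpha> ! Suc i = \<alpha> ! i" if "i < n - 3" for i
  proof -
    have idx: "i < n - 3 - 0" "n - 3 - 0 - 1 - i = n - 4 - i" using that by auto
    have mirror: "\<beta> ! i = \<beta> ! (n - 4 - i)"
      using head' idx(1) unfolding palindromic_head_def j' d' idx(2)[symmetric] by blast
    have "\<alpha> ! Suc i = \<beta> ! i" using \<beta>_shift[of i] that by simp
    also note mirror
    also have "\<beta> ! (n - 4 - i) = \<alpha> ! Suc (n - 4 - i)" using \<beta>_shift[of "n - 4 - i"] n4 by simp
    also have "Suc (n - 4 - i) = n - 3 - i" using that by simp
    also have "\<alpha> ! (n - 3 - i) = \<alpha> ! i" using pal[of i] that by simp
    finally show ?thesis .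
  qed
  have ones: "\<alpha> ! i = 1" if "i < n - 2" for i
    using that
  proof (induction i)
    case 0
    then show ?case using t t0 by simp
  next
    case (Suc i)
    then show ?case using step[of i] by simp
  qed
  have all_ones: "\<alpha> ! i = 1" if "i < n - 1" for i
    using ones[of i] a2 that by (cases "i = n - 2") auto
  \<comment> \<open>Reading backwards from \<open>n - 2\<close> visits the ones first and index
    \<open>n - 1\<close> last, so it reproduces \<open>\<alpha>\<close>.\<close>
  have "\<alpha> ! bw n (n - 2) i = \<alpha> ! i" if "i < n" for i
    using all_ones[of i] all_ones[of "n - 2 - i"] that n by (cases "i = n - 1") (auto simp: bw_def)
  moreover have "asym_bracelet k n ((!) \<alpha>)" using A_iff_asym_bracelet[of \<alpha> n k] \<alpha>(1) len n by simp
  ultimately show False using asym_bracelet_not_palindrome[of k n "(!) \<alpha>" "n - 2"] n by auto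
qed

text \<open>The joining letter \<open>v\<close> is the difference between the letter sums of the
  parent and of \<open>s\<close>; siblings with equal \<open>s\<close> therefore share it.\<close>

lemma joined_letter:
  assumes "\<alpha> \<in> A k n" and "par_step k \<alpha> = Some (\<alpha>[p := v], p)" "p < n"
  shows "ppos k \<alpha> = p" "sum_list (Par k \<alpha>) = v + sum_list (s_str k \<alpha>)"
proof -
  show "ppos k \<alpha> = p" using assms(2) by (simp add: ppos_def)
  then show "sum_list (Par k \<alpha>) = v + sum_list (s_str k \<alpha>)"
    using assms A_length[OF assms(1)] by (simp add: Par_def s_str_def sum_list_update del: sum_list_append)
qed

text \<open>A final \<open>k - 1\<close> becomes 0 and the smallest rotation keeps the letter sum,
  so the joining letter is 0.\<close>

lemma joined_letter_LS:
  assumes "\<alpha> \<in> A k n" "3 \<le> n" "3 \<le> k" and "par_step k \<alpha> = Some (LastSymbol k \<alpha>, n - 1)"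
    and "palindromic_head k n ((!) \<alpha>) j d"
  shows "ppos k \<alpha> = n - 1" "s_str k \<alpha> = butlast \<alpha>" "sum_list (Par k \<alpha>) = sum_list (s_str k \<alpha>)"
proof -
  note len = A_length[OF assms(1)]
  show p: "ppos k \<alpha> = n - 1" using assms(4) by (simp add: ppos_def)
  show s: "s_str k \<alpha> = butlast \<alpha>" using p len assms(2) by (simp add: s_str_def butlast_conv_take)
  have "last \<alpha> = k - 1"
    using palindromic_head_last[OF assms(5)] len assms(2) by (subst last_conv_nth) auto
  then show "sum_list (Par k \<alpha>) = sum_list (s_str k \<alpha>)"
    using assms(3,4) unfolding s by (simp add: Par_def LastSymbol_def sum_list_neck)
qed

text \<open>The joining letter \<open>\<alpha> ! t - 1\<close> is compared with that of
  \<open>\<beta>\<close> for each operation that can apply to \<open>\<beta>\<close>.\<close>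

lemma FNM_chain:
  assumes n: "3 \<le> n" and k: "3 \<le> k" and \<alpha>: "\<alpha> \<in> A k n" "\<alpha> \<noteq> r_str n k"
    and \<beta>: "\<beta> \<in> A k n" "\<beta> \<noteq> r_str n k" and ne: "\<alpha> \<noteq> \<beta>"
    and par: "Par k \<alpha> = Par k \<beta>" and s: "s_str k \<alpha> = s_str k \<beta>"
    and FNM: "par_step k \<alpha> = Some (\<alpha>[t := \<alpha> ! t - 1], t)" "t < n" "\<alpha> ! t \<noteq> 0"
      "\<And>i. i < t \<Longrightarrow> \<alpha> ! i = 0" "\<alpha>[t := \<alpha> ! t - 1] \<in> A k n" "\<alpha> ! (n - 2) \<le> \<alpha> ! t"
      "palindromic_head k n ((!) \<alpha>) j d"
  shows False
proof -
  note A = joined_letter[OF \<alpha>(1) FNM(1,2)]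
  note len = A_length[OF \<alpha>(1)] A_length[OF \<beta>(1)]
  have s\<alpha>: "s_str k \<alpha> = drop (Suc t) \<alpha> @ take t \<alpha>" using A(1) by (simp add: s_str_def)
  show False
    using \<beta> n k
  proof (cases rule: par_step_cases)
    case (LNM p)
    note B = joined_letter[OF \<beta>(1) LNM(1,2)]
    have s\<beta>: "s_str k \<beta> = drop (Suc p) \<beta> @ take p \<beta>" using B(1) by (simp add: s_str_def)
    have letter: "2 \<le> \<alpha> ! t" "\<beta> ! p = \<alpha> ! t - 2" using A(2) B(2) par s by auto
    note eq = FNM_sibling_eq[OF n k \<beta>(1) FNM(2) letter(1) FNM(4,5,7) LNM(2) letter(2)]
    \<comment> \<open>\<open>LastNonMax\<close> at \<open>t\<close> needs \<open>k - 1\<close> at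
      all later indices, where \<open>\<beta>\<close> agrees with \<open>\<alpha>\<close>.\<close>
    have "\<beta> = \<alpha>[t := \<alpha> ! t - 2]" "p = t" using eq s\<alpha> s\<beta> s by auto
    moreover obtain i where "t < i" "i < n" "\<alpha> ! i \<noteq> k - 1"
      using FNM_nonmax_after_first_nonmin[OF n k \<alpha> FNM(4,6,7)] by blast
    ultimately show False using LNM(4)[of i] by simp
  next
    case (LS j' d')
    note B = joined_letter_LS[OF \<beta>(1) n k LS]
    have "\<alpha> ! t = 1" using A(2) B(3) par s FNM(3) by simp
    then show False
      using FNM_not_joined_LS[OF n k \<alpha> \<beta>(1) FNM(2) _ FNM(4) _ FNM(7) LS(2)] FNM(6) B(2) s s\<alpha> by simp
  next
    case (FNM t' j' d')
    note B = joined_letter[OF \<beta>(1) FNM(1,2)]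
    have s\<beta>: "s_str k \<beta> = drop (Suc t') \<beta> @ take t' \<beta>" using B(1) by (simp add: s_str_def)
    have "\<alpha> ! t = \<beta> ! t'" using A(2) B(2) par s \<open>\<alpha> ! t \<noteq> 0\<close> \<open>\<beta> ! t' \<noteq> 0\<close> by simp
    then show False
      using A_joined_same_letter[OF \<alpha>(1) \<beta>(1) \<open>t < n\<close> \<open>t' < n\<close>] s s\<alpha> s\<beta> ne by simp
  next
    case SLNM
    have p: "n - 3 < n" using n by simp
    note B = joined_letter[OF \<beta>(1) SLNM(1) p]
    have s\<beta>: "s_str k \<beta> = drop (Suc (n - 3)) \<beta> @ take (n - 3) \<beta>" using B(1) by (simp add: s_str_def)
    have "\<alpha> ! t = 2" using A(2) B(2) par s by auto
    then have letter: "2 \<le> \<alpha> ! t" "\<beta> ! (n - 3) = \<alpha> ! t - 2" using SLNM(5) by auto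
    note eq = FNM_sibling_eq[OF n k \<beta>(1) FNM(2) letter(1) FNM(4,5,7) p letter(2)]
    have eqs: "\<beta> = \<alpha>[t := \<alpha> ! t - 2]" "n - 3 = t" using eq s\<alpha> s\<beta> s by auto
    \<comment> \<open>Only zeros precede the final 12 of \<open>\<beta>\<close>, which makes it the
      root.\<close>
    have "\<beta> ! i = 0" if "i < n - 2" for i
    proof (cases "i = n - 3")
      case False
      then have "i < t" using that eqs(2) by simp
      then show ?thesis using FNM(4)[of i] eqs(1) by simp
    qed (use SLNM(5) in simp)
    then have "\<beta> = r_str n k" using SLNM(2-4) by (intro r_str_eqI[OF len(2) n]) simp_all
    then show False using \<beta>(2) by simp
  qed
qed

theorem mainTheorem10:
  fixes n k :: nat and \<alpha> \<alpha>' :: "nat list"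
  assumes "n \<ge> 3" and "k \<ge> 3"
    and "\<alpha> \<in> A k n - {r_str n k}" and "\<alpha>' \<in> A k n - {r_str n k}"
    and "\<alpha> \<noteq> \<alpha>'" and "Par k \<alpha> = Par k \<alpha>'"
  shows "s_str k \<alpha> \<noteq> s_str k \<alpha>'"
proof
  assume s: "s_str k \<alpha> = s_str k \<alpha>'"
  have \<alpha>: "\<alpha> \<in> A k n" "\<alpha> \<noteq> r_str n k" and \<alpha>': "\<alpha>' \<in> A k n" "\<alpha>' \<noteq> r_str n k"
    using assms(3,4) by auto
  \<comment> \<open>Without \<open>FirstNonMin\<close> the modified letter is the predecessor of the
    joining letter \<open>y\<close> modulo \<open>k\<close>. The premise \<open>nF\<close> is the
    \<open>FirstNonMin\<close> case in refuted form, to be discharged by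
    \<open>FNM_chain\<close>.\<close>
  have letter: "(\<exists>y. sum_list (Par k \<gamma>) = y + sum_list (s_str k \<gamma>)
      \<and> \<gamma> ! ppos k \<gamma> = (if y = 0 then k - 1 else y - 1) \<and> ppos k \<gamma> < n)"
    if \<gamma>: "\<gamma> \<in> A k n" "\<gamma> \<noteq> r_str n k"
      and nF: "\<And>t j d. par_step k \<gamma> = Some (\<gamma>[t := \<gamma> ! t - 1], t) \<Longrightarrow> t < n \<Longrightarrow> \<gamma> ! t \<noteq> 0 \<Longrightarrow>
        (\<And>i. i < t \<Longrightarrow> \<gamma> ! i = 0) \<Longrightarrow> \<gamma>[t := \<gamma> ! t - 1] \<in> A k n \<Longrightarrow> \<gamma> ! (n - 2) \<le> \<gamma> ! t \<Longrightarrow>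
        palindromic_head k n ((!) \<gamma>) j d \<Longrightarrow> False" for \<gamma>
    using \<gamma> assms(1,2)
  proof (cases rule: par_step_cases)
    case (LNM p)
    note B = joined_letter[OF \<gamma>(1) LNM(1,2)]
    show ?thesis by (rule exI[of _ "Suc (\<gamma> ! p)"]) (use B LNM(2) in simp)
  next
    case (LS j d)
    note B = joined_letter_LS[OF \<gamma>(1) assms(1,2) LS]
    show ?thesis
      by (rule exI[of _ 0]) (use B palindromic_head_last[OF LS(2)] assms(1) in simp)
  next
    case (FNM t j d)
    then show ?thesis using nF[of t j d] by blast
  next
    case SLNM
    have p: "n - 3 < n" using assms(1) by simp
    note B = joined_letter[OF \<gamma>(1) SLNM(1) p]
    show ?thesis by (rule exI[of _ 1]) (use B SLNM(5) p in simp)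
  qed
  obtain y where y: "sum_list (Par k \<alpha>) = y + sum_list (s_str k \<alpha>)"
    "\<alpha> ! ppos k \<alpha> = (if y = 0 then k - 1 else y - 1)" "ppos k \<alpha> < n"
    using letter[OF \<alpha>] FNM_chain[OF assms(1,2) \<alpha> \<alpha>' assms(5,6) s] by blast
  obtain y' where y': "sum_list (Par k \<alpha>') = y' + sum_list (s_str k \<alpha>')"
    "\<alpha>' ! ppos k \<alpha>' = (if y' = 0 then k - 1 else y' - 1)" "ppos k \<alpha>' < n"
    using letter[OF \<alpha>'] FNM_chain[OF assms(1,2) \<alpha>' \<alpha> assms(5)[symmetric] assms(6)[symmetric] s[symmetric]]
    by blast
  have "y = y'" using y(1) y'(1) assms(6) s by simp
  then have "\<alpha> ! ppos k \<alpha> = \<alpha>' ! ppos k \<alpha>'" using y(2) y'(2) by simp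
  then have "\<alpha> = \<alpha>'"
    using A_joined_same_letter[OF \<alpha>(1) \<alpha>'(1) y(3) y'(3)] s by (simp add: s_str_def)
  then show False using assms(5) by simp
qed

end
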